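(* Let $G$ be an open subset of $\mathbb R$ containing $0$. Let $A$ and $B$ be unital complex Banach algebras with continuous involutions, and let $\pi:G\to\mathcal B(A,B)$ be a real analytic map whose values are unit-preserving ${}^*$-homomorphisms $A\to B$, such that $\pi(0)$ is surjective. Suppose that the spectrum (in $A$) of each element of $\operatorname{Ker}\pi(0)$ is $\{0\}$. Let $b(\cdot):G\to S_p(B)\ (\subset B)$ be a real analytic map. Then there exist an open set $H\subset\mathbb R$ with $0\in H\subset G$ and a real analytic map $a(\cdot):H\to S_p(A)\ (\subset A)$ such that $$\pi(\lambda)a(\lambda)=b(\lambda)\quad\text{for each }\lambda\in H.$$
   Context: All Banach algebras have a unit of norm $1$. Fix an integer $n\ge2$, distinct $\lambda_1,\dots,\lambda_n\in\mathbb R$, and let $p(\lambda)=\prod_{i=1}^n(\lambda-\lambda_i)$. For a unital complex Banach algebra $A$ with continuous involution ${}^*$ (conjugate-linear), $S_p(A)=\{a\in A\mid a=a^*,\ p(a)=0\}$. $\mathcal B(A,B)$ is the Banach space of all bounded linear operators $A\to B$. A map $f$ from an open subset $G$ of $\mathbb R$ to a Banach space is real analytic if for each $x_0\in G$ it has locally a power series expansion $f(x)=\sum_{i=0}^\infty a_i(x-x_0)^i$. A map into $S_p(A)$ is real analytic if it is so as a map into $A$. *)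

theory Defs
  imports "HOL-Analysis.Analysis" "HOL-Computational_Algebra.Polynomial"
begin

class scaleC =
  fixes scaleC :: "complex \<Rightarrow> 'a \<Rightarrow> 'a" (infixr \<open>*\<^sub>C\<close> 75)

class complex_normed_vector = real_normed_vector + scaleC +
  assumes scaleC_add_right: "c *\<^sub>C (x + y) = c *\<^sub>C x + c *\<^sub>C y"
    and scaleC_add_left: "(c + d) *\<^sub>C x = c *\<^sub>C x + d *\<^sub>C x"
    and scaleC_scaleC: "c *\<^sub>C d *\<^sub>C x = (c * d) *\<^sub>C x"
    and scaleC_of_real: "complex_of_real r *\<^sub>C x = r *\<^sub>R x"
    and norm_scaleC: "norm (c *\<^sub>C x) = cmod c * norm x"

class complex_banach = complex_normed_vector + banach

class complex_banach_algebra_1 = complex_banach + real_normed_algebra_1 +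
  assumes mult_scaleC_left: "(c *\<^sub>C x) * y = c *\<^sub>C (x * y)"
    and mult_scaleC_right: "x * (c *\<^sub>C y) = c *\<^sub>C (x * y)"

text \<open>The involution is only assumed continuous, not isometric; in particular these need not be
  C*-algebras. Continuity is phrased with preimages because \<open>continuous_on\<close> cannot be used on the
  type variable of a class specification.\<close>

class banach_star_algebra_1 = complex_banach_algebra_1 +
  fixes star :: "'a \<Rightarrow> 'a"
  assumes star_star: "star (star x) = x"
    and star_add: "star (x + y) = star x + star y"
    and star_scaleC: "star (c *\<^sub>C x) = cnj c *\<^sub>C star x"
    and star_mult: "star (x * y) = star y * star x"
    and open_vimage_star: "open U \<Longrightarrow> open (star -` U)"

lemma continuous_star: "continuous_on UNIV (star :: 'a::banach_star_algebra_1 \<Rightarrow> 'a)"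
  using continuous_on_open_vimage[OF open_UNIV] open_vimage_star by auto

definition spectrum :: "'a::complex_banach_algebra_1 \<Rightarrow> complex set" where
  "spectrum a = {c. \<not> (\<exists>b. (c *\<^sub>C 1 - a) * b = 1 \<and> b * (c *\<^sub>C 1 - a) = 1)}"

text \<open>The library function \<open>poly\<close> requires a commutative semiring.\<close>

definition poly_alg :: "real poly \<Rightarrow> 'a::real_algebra_1 \<Rightarrow> 'a" where
  "poly_alg p a = (\<Sum>i\<le>degree p. coeff p i *\<^sub>R a ^ i)"

definition S_alg :: "real poly \<Rightarrow> 'a::banach_star_algebra_1 set" where
  "S_alg p = {a. a = star a \<and> poly_alg p a = 0}"

definition real_analytic_on :: "(real \<Rightarrow> 'a::real_normed_vector) \<Rightarrow> real set \<Rightarrow> bool"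
    (infixl \<open>real'_analytic'_on\<close> 50) where
  "f real_analytic_on G \<longleftrightarrow>
     (\<forall>x0\<in>G. \<exists>c. \<exists>\<epsilon>>0. \<forall>x\<in>G. \<bar>x - x0\<bar> < \<epsilon> \<longrightarrow> (\<lambda>i. (x - x0) ^ i *\<^sub>R c i) sums f x)"

text \<open>The library type of bounded operators consists of real-linear ones. The complex-linear ones
  form a closed subspace, which carries the operator norm.\<close>

typedef (overloaded) ('a::complex_normed_vector, 'b::complex_normed_vector) cblinfun =
  "{f :: 'a \<Rightarrow>\<^sub>L 'b. \<forall>c x. f (c *\<^sub>C x) = c *\<^sub>C f x}"
  morphisms blinfun_of_cblinfun Abs_cblinfun
proof
  show "0 \<in> {f :: 'a \<Rightarrow>\<^sub>L 'b. \<forall>c x. f (c *\<^sub>C x) = c *\<^sub>C f x}"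
    using scaleC_add_right[of _ "0::'b" 0] by simp
qed

setup_lifting type_definition_cblinfun

lift_definition cblinfun_apply ::
  "('a::complex_normed_vector, 'b::complex_normed_vector) cblinfun \<Rightarrow> 'a \<Rightarrow> 'b"
  is blinfun_apply .

lemma scaleC_zero: "c *\<^sub>C (0::'a::complex_normed_vector) = 0"
  using scaleC_add_right[of c "0::'a" 0] by simp

lemma scaleC_minus: "c *\<^sub>C (- x) = - (c *\<^sub>C (x::'a::complex_normed_vector))"
  using scaleC_add_right[of c x "- x"] by (simp add: scaleC_zero eq_neg_iff_add_eq_0 add.commute)

lemma scaleC_diff: "c *\<^sub>C (x - y) = c *\<^sub>C x - c *\<^sub>C (y::'a::complex_normed_vector)"
  using scaleC_add_right[of c x "- y"] by (simp add: scaleC_minus)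

lemma scaleC_scaleR: "c *\<^sub>C r *\<^sub>R x = r *\<^sub>R c *\<^sub>C (x::'a::complex_normed_vector)"
  by (simp only: scaleC_of_real[symmetric] scaleC_scaleC mult.commute)

lemma bounded_linear_scaleC: "bounded_linear (scaleC c :: 'a \<Rightarrow> 'a::complex_normed_vector)"
  by (rule bounded_linear_intro[where K = "cmod c"])
    (auto simp: scaleC_add_right scaleC_scaleR norm_scaleC)

lemma Blinfun_scaleC_apply: "blinfun_apply (Blinfun (scaleC c)) x = c *\<^sub>C (x::'a::complex_normed_vector)"
  by (simp only: bounded_linear_Blinfun_apply[OF bounded_linear_scaleC])

instantiation cblinfun :: (complex_normed_vector, complex_normed_vector) complex_normed_vector
begin

lift_definition zero_cblinfun :: "('a, 'b) cblinfun" is 0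
  by (simp add: scaleC_zero)

lift_definition plus_cblinfun :: "('a, 'b) cblinfun \<Rightarrow> ('a, 'b) cblinfun \<Rightarrow> ('a, 'b) cblinfun" is "(+)"
  by (simp add: blinfun.add_left scaleC_add_right)

lift_definition minus_cblinfun :: "('a, 'b) cblinfun \<Rightarrow> ('a, 'b) cblinfun \<Rightarrow> ('a, 'b) cblinfun" is "(-)"
  by (simp add: blinfun.diff_left scaleC_diff)

lift_definition uminus_cblinfun :: "('a, 'b) cblinfun \<Rightarrow> ('a, 'b) cblinfun" is uminus
  by (simp add: blinfun.minus_left scaleC_minus)

lift_definition scaleR_cblinfun :: "real \<Rightarrow> ('a, 'b) cblinfun \<Rightarrow> ('a, 'b) cblinfun" is scaleR
  by (simp add: blinfun.scaleR_left scaleC_scaleR)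

lift_definition scaleC_cblinfun :: "complex \<Rightarrow> ('a, 'b) cblinfun \<Rightarrow> ('a, 'b) cblinfun"
  is "\<lambda>c f. Blinfun (scaleC c) o\<^sub>L f"
  by (simp add: Blinfun_scaleC_apply scaleC_scaleC mult.commute)

lift_definition norm_cblinfun :: "('a, 'b) cblinfun \<Rightarrow> real" is norm .

definition dist_cblinfun :: "('a, 'b) cblinfun \<Rightarrow> ('a, 'b) cblinfun \<Rightarrow> real"
  where "dist_cblinfun f g = norm (f - g)"

definition sgn_cblinfun :: "('a, 'b) cblinfun \<Rightarrow> ('a, 'b) cblinfun"
  where "sgn_cblinfun f = scaleR (inverse (norm f)) f"

definition [code del]:
  "(uniformity :: (('a, 'b) cblinfun \<times> ('a, 'b) cblinfun) filter) =
     (INF e\<in>{0 <..}. principal {(f, g). dist f g < e})"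

definition open_cblinfun :: "('a, 'b) cblinfun set \<Rightarrow> bool"
  where [code del]: "open_cblinfun S =
    (\<forall>x\<in>S. \<forall>\<^sub>F (x', y) in uniformity. x' = x \<longrightarrow> y \<in> S)"

instance
proof
  fix f g h :: "('a, 'b) cblinfun" and r s :: real and c d :: complex
  show "f + g + h = f + (g + h)" by transfer simp
  show "f + g = g + f" by transfer simp
  show "0 + f = f" by transfer simp
  show "- f + f = 0" by transfer simp
  show "f - g = f + - g" by transfer simp
  show "r *\<^sub>R (f + g) = r *\<^sub>R f + r *\<^sub>R g" by transfer (simp add: scaleR_add_right)
  show "(r + s) *\<^sub>R f = r *\<^sub>R f + s *\<^sub>R f" by transfer (simp add: scaleR_add_left)
  show "r *\<^sub>R s *\<^sub>R f = (r * s) *\<^sub>R f" by transfer simp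
  show "1 *\<^sub>R f = f" by transfer simp
  show "dist f g = norm (f - g)" by (rule dist_cblinfun_def)
  show "sgn f = inverse (norm f) *\<^sub>R f" by (rule sgn_cblinfun_def)
  show "(uniformity :: (('a, 'b) cblinfun \<times> ('a, 'b) cblinfun) filter) =
     (INF e\<in>{0 <..}. principal {(f, g). dist f g < e})"
    by (rule uniformity_cblinfun_def)
  show "open S = (\<forall>x\<in>S. \<forall>\<^sub>F (x', y) in uniformity. x' = x \<longrightarrow> y \<in> S)"
    for S :: "('a, 'b) cblinfun set"
    by (rule open_cblinfun_def)
  show "(norm f = 0) = (f = 0)" by transfer simp
  show "norm (f + g) \<le> norm f + norm g" by transfer (rule norm_triangle_ineq)
  show "norm (r *\<^sub>R f) = \<bar>r\<bar> * norm f" by transfer simp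
  show "c *\<^sub>C (f + g) = c *\<^sub>C f + c *\<^sub>C g"
    by transfer (rule blinfun_eqI, simp add: Blinfun_scaleC_apply blinfun.add_left scaleC_add_right)
  show "(c + d) *\<^sub>C f = c *\<^sub>C f + d *\<^sub>C f"
    by transfer (rule blinfun_eqI, simp add: Blinfun_scaleC_apply blinfun.add_left scaleC_add_left)
  show "c *\<^sub>C d *\<^sub>C f = (c * d) *\<^sub>C f"
    by transfer (rule blinfun_eqI, simp add: Blinfun_scaleC_apply scaleC_scaleC)
  show "complex_of_real r *\<^sub>C f = r *\<^sub>R f"
    by transfer (rule blinfun_eqI, simp add: Blinfun_scaleC_apply blinfun.scaleR_left scaleC_of_real)
  show "norm (c *\<^sub>C f) = cmod c * norm f"
  proof (transfer fixing: c)
    fix f :: "'a \<Rightarrow>\<^sub>L 'b"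
    have le: "norm (Blinfun (scaleC c) o\<^sub>L f) \<le> cmod c * norm f" for c and f :: "'a \<Rightarrow>\<^sub>L 'b"
      by (rule norm_blinfun_bound)
        (auto simp: Blinfun_scaleC_apply norm_scaleC mult.assoc intro!: mult_left_mono norm_blinfun)
    show "norm (Blinfun (scaleC c) o\<^sub>L f) = cmod c * norm f"
    proof (cases "c = 0")
      case True
      then show ?thesis using le[of c f] by simp
    next
      case False
      let ?g = "Blinfun (scaleC c) o\<^sub>L f"
      have "Blinfun (scaleC (inverse c)) o\<^sub>L ?g = f"
        using False scaleC_of_real[of 1]
        by (intro blinfun_eqI) (simp add: Blinfun_scaleC_apply scaleC_scaleC)
      then have "norm f \<le> inverse (cmod c) * norm ?g"
        using le[of "inverse c" ?g] by (simp add: norm_inverse)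
      then show ?thesis using le[of c f] False by (simp add: field_simps)
    qed
  qed
qed

end

lemma dist_cblinfun: "dist f g = dist (blinfun_of_cblinfun f) (blinfun_of_cblinfun g)"
  unfolding dist_norm by transfer simp

instance cblinfun :: (complex_normed_vector, complex_banach) complex_banach
proof
  fix X :: "nat \<Rightarrow> ('a, 'b) cblinfun"
  assume "Cauchy X"
  then have "Cauchy (\<lambda>n. blinfun_of_cblinfun (X n))"
    by (simp add: Cauchy_def dist_cblinfun)
  then obtain L where L: "(\<lambda>n. blinfun_of_cblinfun (X n)) \<longlonglongrightarrow> L"
    using Cauchy_convergent convergent_def by blast
  have lim: "(\<lambda>n. blinfun_of_cblinfun (X n) x) \<longlonglongrightarrow> L x" for x
    using L by (intro tendsto_intros)
  have "L (c *\<^sub>C x) = c *\<^sub>C L x" for c x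
  proof (rule LIMSEQ_unique)
    show "(\<lambda>n. blinfun_of_cblinfun (X n) (c *\<^sub>C x)) \<longlonglongrightarrow> L (c *\<^sub>C x)" by (rule lim)
    have "blinfun_of_cblinfun (X n) (c *\<^sub>C x) = c *\<^sub>C blinfun_of_cblinfun (X n) x" for n
      using blinfun_of_cblinfun[of "X n"] by simp
    then show "(\<lambda>n. blinfun_of_cblinfun (X n) (c *\<^sub>C x)) \<longlonglongrightarrow> c *\<^sub>C L x"
      using bounded_linear.tendsto[OF bounded_linear_scaleC lim] by simp
  qed
  then have "blinfun_of_cblinfun (Abs_cblinfun L) = L" by (simp add: Abs_cblinfun_inverse)
  then have "X \<longlonglongrightarrow> Abs_cblinfun L"
    using L by (simp add: tendsto_iff dist_cblinfun)
  then show "convergent X" by (auto simp: convergent_def)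
qed

definition unital_star_hom ::
  "('a::banach_star_algebra_1, 'b::banach_star_algebra_1) cblinfun \<Rightarrow> bool" where
  "unital_star_hom f \<longleftrightarrow>
     cblinfun_apply f 1 = 1 \<and>
     (\<forall>x y. cblinfun_apply f (x * y) = cblinfun_apply f x * cblinfun_apply f y) \<and>
     (\<forall>x. cblinfun_apply f (star x) = star (cblinfun_apply f x))"

end

theory Submission
  imports Defs "HOL-Computational_Algebra.Field_as_Ring" "HOL-Computational_Algebra.Polynomial_Factorial"
begin

text \<open>
  Let \<open>x\<close> be any analytic self-adjoint lift of \<open>b\<close>. Then \<open>p (x 0)\<close> lies in the kernel of \<open>\<pi> 0\<close>, so
  it is quasinilpotent and the spectrum of \<open>x 0\<close> consists of roots of \<open>p\<close>. A function that is
  constantly \<open>l i\<close> near each root \<open>l i\<close> can therefore be applied to \<open>x t\<close> for small \<open>t\<close>; the result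
  \<open>a t\<close> is a root of \<open>p\<close>, it inherits self-adjointness and analyticity from \<open>x\<close>, and it still lifts
  \<open>b t\<close>, since \<open>b t\<close> is fixed by that function.

  Newton's iteration \<open>y \<mapsto> y - p(y) u(y)\<close>, with \<open>u p' \<equiv> 1\<close> modulo \<open>p\<close>, computes this functional calculus
  algebraically. Each iterate is a real polynomial in \<open>x\<close>, so the iteration commutes with unital
  homomorphisms and with the involution, and it fixes every root of \<open>p\<close>. A step turns \<open>p(y)\<close> into
  a multiple of its square (\<open>newton_step_quadratic\<close>), and hence the iteration converges as soon as
  the spectral radius of \<open>p(x)\<close> is below a threshold that depends on the norm of \<open>x\<close>, even if
  \<open>p(x)\<close> has large norm (\<open>newton_converges\<close>). That quasinilpotence
  makes powers small is \<open>spectrum_zero_power_bound\<close>, the half of the spectral radius formula that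
  needs an argument.

  Analyticity in \<open>t\<close> costs nothing if the iteration runs not on the single elements \<open>x t\<close> but on the
  power series \<open>x\<close> itself, in the Banach algebra of power series with absolutely summable
  coefficients. Replacing \<open>t\<close> by \<open>\<rho> t\<close> with small \<open>\<rho>\<close> brings the norm of a series close to that of its
  constant term, so that the smallness of the powers of \<open>p (x 0)\<close> is all that is needed
  (\<open>newton_converges_disc_series\<close>).

  The lift \<open>x\<close> comes from solving \<open>\<pi> t (x t) = b t\<close> coefficient by coefficient with a bounded right
  inverse of \<open>\<pi> 0\<close>, which the Baire category theorem provides (\<open>surj_bounded_lift\<close>). A geometric
  bound on the coefficients gives convergence (\<open>real_analytic_lift\<close>), and averaging with the adjoint
  makes the lift self-adjoint (\<open>self_adjoint_analytic_lift\<close>).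
\<close>

section \<open>Real polynomials evaluated in an algebra\<close>

lemma poly_alg_altdef:
  assumes "degree p \<le> N"
  shows "poly_alg p a = (\<Sum>i\<le>N. coeff p i *\<^sub>R a ^ i)"
  unfolding poly_alg_def using assms
  by (intro sum.mono_neutral_left) (auto simp: coeff_eq_0)

lemma poly_alg_0 [simp]: "poly_alg 0 a = 0"
  by (simp add: poly_alg_def)

lemma poly_alg_pCons: "poly_alg (pCons c p) a = c *\<^sub>R 1 + a * poly_alg p a"
proof -
  have "poly_alg (pCons c p) a = (\<Sum>i\<le>Suc (degree p). coeff (pCons c p) i *\<^sub>R a ^ i)"
    by (rule poly_alg_altdef) (rule degree_pCons_le)
  also have "\<dots> = c *\<^sub>R 1 + (\<Sum>i\<le>degree p. coeff p i *\<^sub>R a ^ Suc i)"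
    by (simp add: sum.atMost_Suc_shift del: power_Suc sum.atMost_Suc)
  finally show ?thesis
    by (simp add: poly_alg_def sum_distrib_left)
qed

lemma poly_alg_1 [simp]: "poly_alg 1 a = 1"
  by (simp add: one_pCons poly_alg_pCons)

lemma poly_alg_add: "poly_alg (p + q) a = poly_alg p a + poly_alg q a"
  by (induction p q rule: poly_induct2) (auto simp: poly_alg_pCons algebra_simps)

lemma poly_alg_smult: "poly_alg (smult c p) a = c *\<^sub>R poly_alg p a"
  by (induction p) (auto simp: poly_alg_pCons algebra_simps)

lemma poly_alg_minus: "poly_alg (- p) a = - poly_alg p a"
  by (induction p) (auto simp: poly_alg_pCons algebra_simps)

lemma poly_alg_diff: "poly_alg (p - q) a = poly_alg p a - poly_alg q a"
  using poly_alg_add[of p "- q" a] by (simp add: poly_alg_minus)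

lemma poly_alg_mult: "poly_alg (p * q) a = poly_alg p a * poly_alg q a"
  by (induction p) (auto simp: poly_alg_pCons poly_alg_add poly_alg_smult algebra_simps)

lemma poly_alg_pcompose: "poly_alg (pcompose p q) a = poly_alg p (poly_alg q a)"
  by (induction p)
    (auto simp: pcompose_pCons poly_alg_pCons poly_alg_add poly_alg_mult)

lemma poly_alg_X [simp]: "poly_alg [:0, 1:] a = a"
  by (simp add: poly_alg_pCons)

lemma poly_alg_hom:
  assumes add: "\<And>x y. h (x + y) = h x + h y" and scale: "\<And>r x. h (r *\<^sub>R x) = r *\<^sub>R h x"
    and mult: "\<And>x y. h (x * y) = h x * h y" and one: "h 1 = 1"
  shows "h (poly_alg p a) = poly_alg p (h a)"
proof -
  have "h 0 = 0" using scale[of 0 0] by simp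
  then show ?thesis
    by (induction p) (auto simp: poly_alg_pCons assms)
qed

text \<open>A polynomial in one element does not see the order of factors, so antihomomorphisms such as an
  involution commute with evaluation just as homomorphisms do.\<close>

lemma poly_alg_hom_rev:
  assumes add: "\<And>x y. h (x + y) = h x + h y" and scale: "\<And>r x. h (r *\<^sub>R x) = r *\<^sub>R h x"
    and mult: "\<And>x y. h (x * y) = h y * h x" and one: "h 1 = 1"
  shows "h (poly_alg p a) = poly_alg p (h a)"
proof -
  have "h 0 = 0" using scale[of 0 0] by simp
  moreover have "poly_alg q b * b = b * poly_alg q b" for q and b :: 'b
    using poly_alg_mult[of q "[:0,1:]" b] poly_alg_mult[of "[:0,1:]" q b]
    by (simp add: mult.commute)
  ultimately show ?thesis
    by (induction p) (auto simp: poly_alg_pCons assms)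
qed

lemma continuous_on_poly_alg:
  "continuous_on S (poly_alg p :: 'a::real_normed_algebra_1 \<Rightarrow> 'a)"
  by (induction p) (auto simp: poly_alg_pCons intro!: continuous_intros cong: continuous_on_cong)

section \<open>Newton's iteration for a polynomial with simple roots\<close>

text \<open>First-order Taylor expansion of \<open>p(X + h)\<close>. It is a statement about polynomials, so that it can
  later be evaluated in a noncommutative algebra.\<close>

lemma pcompose_taylor:
  fixes p h :: "'a::idom poly"
  shows "h\<^sup>2 dvd pcompose p ([:0, 1:] + h) - (p + h * pderiv p)" 
proof (induction p)
  case (pCons c p)
  let ?X = "[:0, 1::'a:]"
  obtain s where s: "pcompose p (?X + h) = p + h * pderiv p + h\<^sup>2 * s"
    using pCons.IH by (auto simp: dvd_def algebra_simps)
  have 1: "pcompose (pCons c p) (?X + h) = [:c:] + (?X + h) * (p + h * pderiv p + h\<^sup>2 * s)"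
    by (simp only: pcompose_pCons s)
  have 2: "pCons c p = [:c:] + ?X * p"
    by simp
  have 3: "pderiv (pCons c p) = p + ?X * pderiv p"
    by (simp add: pderiv_pCons)
  have "pcompose (pCons c p) (?X + h) - (pCons c p + h * pderiv (pCons c p))
      = [:c:] + (?X + h) * (p + h * pderiv p + h\<^sup>2 * s)
        - ([:c:] + ?X * p + h * (p + ?X * pderiv p))"
    unfolding 1 3 unfolding 2 ..
  also have "\<dots> = h\<^sup>2 * (?X * s + pderiv p + h * s)"
    by (simp only: algebra_simps power2_eq_square)
  finally show ?case by (rule dvdI)
qed simp

text \<open>The factor \<open>u\<close> stands for \<open>1 / p'\<close>, which need not make sense in an algebra. An inverse of \<open>p'\<close>
  modulo \<open>p\<close> serves equally well and keeps the step polynomial.\<close>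

definition newton_step :: "real poly \<Rightarrow> real poly \<Rightarrow> 'a::real_algebra_1 \<Rightarrow> 'a" where
  "newton_step p u y = y - poly_alg p y * poly_alg u y"

text \<open>Simple roots make \<open>p'\<close> nonzero at every root, hence coprime to each linear factor of \<open>p\<close>.\<close>

lemma squarefree_bezout:
  fixes l :: "nat \<Rightarrow> real"
  assumes inj: "inj_on l {1..n}" and p: "p = (\<Prod>i=1..n. [:- l i, 1:])"
  obtains u where "p dvd u * pderiv p - 1"
proof -
  have "coprime [:- l i, 1:] (pderiv p)" if i: "i \<in> {1..n}" for i
  proof (rule prime_elem_imp_coprime)
    show "prime_elem [:- l i, 1:]"
      by (intro prime_elem_linear_field_poly) auto
    define r where "r = (\<Prod>j\<in>{1..n} - {i}. [:- l j, 1:])"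
    have p_eq: "p = [:- l i, 1:] * r"
      unfolding p r_def by (rule prod.remove[where g = "\<lambda>j. [:- l j, 1:]"]) (use i in auto)
    have "poly (pderiv p) (l i) = poly (pderiv ([:- l i, 1:] * r)) (l i)"
      by (rule arg_cong[OF p_eq])
    also have "\<dots> = poly r (l i)"
      by (simp only: pderiv_mult poly_add poly_mult pderiv_pCons)
        (simp only: poly_pCons poly_add poly_0 pderiv_0 mult_zero_left, simp)
    also have "\<dots> \<noteq> 0"
    proof -
      have "l i - l j \<noteq> 0" if "j \<in> {1..n} - {i}" for j
        using inj_on_eq_iff[OF inj, of i j] i that by simp
      then show ?thesis
        by (simp add: r_def poly_prod)
    qed
    finally show "\<not> [:- l i, 1:] dvd pderiv p"
      unfolding poly_eq_0_iff_dvd .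
  qed
  then have "coprime p (pderiv p)"
    by (subst p) (rule prod_coprime_left)
  then have bezout: "fst (bezout_coefficients p (pderiv p)) * p
      + snd (bezout_coefficients p (pderiv p)) * pderiv p = 1"
    by (simp add: bezout_coefficients_fst_snd)
  have "b * q - 1 = p * - a" if "a * p + b * q = 1" for a b p q :: "real poly"
    unfolding that[symmetric] by simp
  from this[OF bezout] have "snd (bezout_coefficients p (pderiv p)) * pderiv p - 1
      = p * - fst (bezout_coefficients p (pderiv p))" .
  then have "p dvd snd (bezout_coefficients p (pderiv p)) * pderiv p - 1"
    by (rule dvdI)
  then show thesis by (rule that)
qed

text \<open>By Taylor, \<open>p(X - p u) = p - p (u p')\<close> modulo \<open>p\<^sup>2\<close>, and \<open>u p' = 1\<close> modulo \<open>p\<close> cancels the terms of first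
  order in \<open>p\<close>.\<close>

lemma newton_step_quadratic:
  assumes u: "p dvd u * pderiv p - 1"
  obtains g where "\<And>y :: 'a::real_algebra_1.
    poly_alg p (newton_step p u y) = poly_alg p y * poly_alg p y * poly_alg g y"
proof -
  let ?N = "[:0, 1:] - p * u"
  obtain s where s: "pcompose p ?N = p + (- p * u) * pderiv p + (- p * u)\<^sup>2 * s"
    using pcompose_taylor[of "- p * u" p] by (auto simp: dvd_def algebra_simps)
  obtain v where v: "u * pderiv p = 1 + p * v" using u by (auto simp: dvd_def algebra_simps)
  have "pcompose p ?N = p - p * (u * pderiv p) + p * p * (u * u * s)"
    unfolding s by (simp add: algebra_simps power2_eq_square)
  also have "\<dots> = p * p * (u * u * s - v)"
    unfolding v by (simp add: algebra_simps)
  finally have *: "pcompose p ?N = p * p * (u * u * s - v)" .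
  show thesis
  proof (rule that)
    fix y :: 'a
    have "newton_step p u y = poly_alg ?N y"
      by (simp only: newton_step_def poly_alg_diff poly_alg_mult poly_alg_X)
    then show "poly_alg p (newton_step p u y) = poly_alg p y * poly_alg p y * poly_alg (u * u * s - v) y"
      by (simp only: poly_alg_pcompose[symmetric] * poly_alg_mult)
  qed
qed

lemma newton_step_funpow_hom:
  assumes add: "\<And>x y. h (x + y) = h x + h y" and scale: "\<And>r x. h (r *\<^sub>R x) = r *\<^sub>R h x"
    and mult: "\<And>x y. h (x * y) = h x * h y" and one: "h 1 = 1"
  shows "h ((newton_step p u ^^ k) x) = (newton_step p u ^^ k) (h x)"
proof (induction k)
  case (Suc k)
  have "h (a - b) = h a - h b" for a b
    using add[of "a" "(-1) *\<^sub>R b"] scale[of "-1" b] by simp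
  then have "h (newton_step p u y) = newton_step p u (h y)" for y
    by (simp add: newton_step_def mult poly_alg_hom[of h, OF add scale mult one])
  with Suc show ?case by simp
qed simp

lemma newton_step_funpow_root: "poly_alg p b = 0 \<Longrightarrow> (newton_step p u ^^ k) b = b"
  by (induction k) (auto simp: newton_step_def)

section \<open>Quasinilpotent elements\<close>

lemma scaleC_zero_left: "0 *\<^sub>C x = (0 :: 'a::complex_normed_vector)"
  using scaleC_of_real[of 0 x] by simp

lemma scaleC_one: "1 *\<^sub>C x = (x :: 'a::complex_normed_vector)"
  using scaleC_of_real[of 1 x] by simp

lemma scaleC_sum_left: "(\<Sum>i\<in>I. f i) *\<^sub>C x = (\<Sum>i\<in>I. f i *\<^sub>C (x :: 'a::complex_normed_vector))"
  by (induction I rule: infinite_finite_induct) (auto simp: scaleC_add_left scaleC_zero_left)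

lemma scaleC_left_diff: "(c - d) *\<^sub>C x = c *\<^sub>C x - d *\<^sub>C (x :: 'a::complex_normed_vector)"
  using scaleC_add_left[of "c - d" d x] by (simp add: algebra_simps)

lemma scaleC_power: "(c *\<^sub>C x) ^ m = (c ^ m) *\<^sub>C (x ^ m :: 'a::complex_banach_algebra_1)"
  by (induction m) (auto simp: scaleC_one mult_scaleC_left mult_scaleC_right scaleC_scaleC mult.commute)

lemma geometric_sum_mult: "(\<Sum>i<m. x ^ i) * (1 - x) = 1 - (x :: 'a::ring_1) ^ m"
proof (induction m)
  case (Suc m)
  have "(\<Sum>i<Suc m. x ^ i) * (1 - x) = (\<Sum>i<m. x ^ i) * (1 - x) + x ^ m * (1 - x)"
    by (simp add: distrib_right)
  also have "\<dots> = 1 - x ^ Suc m"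
    unfolding Suc.IH power_Suc2 by (simp add: right_diff_distrib)
  finally show ?case .
qed simp

text \<open>If the spectrum of \<open>q\<close> is \<open>{0}\<close>, then \<open>1 - c q\<close> is invertible for every complex \<open>c\<close>. That
  \<open>r\<^sup>m \<parallel>q\<^sup>m\<parallel>\<close> tends to \<open>0\<close> for every \<open>r\<close> is derived here by an elementary argument of Rickart, which
  replaces Cauchy's integral over a circle by averages of the resolvent over roots of unity.\<close>

locale quasinilpotent_resolvent =
  fixes q :: "'a::complex_banach_algebra_1" and R :: "complex \<Rightarrow> 'a"
  assumes right_inverse: "(1 - c *\<^sub>C q) * R c = 1"
    and left_inverse: "R c * (1 - c *\<^sub>C q) = 1"
begin

lemma resolvent_identity: "R c - R d = (c - d) *\<^sub>C (R c * q * R d)"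
proof -
  have "R c - R d = R c * ((1 - d *\<^sub>C q) * R d) - (R c * (1 - c *\<^sub>C q)) * R d"
    by (simp add: right_inverse left_inverse)
  also have "\<dots> = R c * ((1 - d *\<^sub>C q) - (1 - c *\<^sub>C q)) * R d"
    by (simp add: algebra_simps)
  also have "(1 - d *\<^sub>C q) - (1 - c *\<^sub>C q) = (c - d) *\<^sub>C q"
    by (simp add: scaleC_left_diff)
  finally show ?thesis by (simp add: mult_scaleC_left mult_scaleC_right)
qed

lemma norm_resolvent_diff_le: "norm (R c - R d) \<le> cmod (c - d) * (norm (R c) * norm q * norm (R d))"
  unfolding resolvent_identity norm_scaleC
  by (intro mult_left_mono order.trans[OF norm_mult_ineq] mult_right_mono) auto

text \<open>Near \<open>d\<close> the resolvent identity bounds \<open>\<parallel>R c\<parallel>\<close> by \<open>2 \<parallel>R d\<parallel>\<close>: the difference is at most half of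
  \<open>\<parallel>R c\<parallel>\<close>. Inserting this bound in the identity gives continuity.\<close>

lemma continuous_resolvent: "continuous_on S R"
proof -
  have "R \<midarrow>d\<rightarrow> R d" for d
  proof -
    define K where "K = norm q * norm (R d)"
    have K: "K \<ge> 0" by (simp add: K_def)
    have "\<forall>\<^sub>F c in at d. cmod (c - d) < 1 / (2 * (K + 1))"
      using K by (auto simp: eventually_at dist_norm intro!: exI[of _ "1 / (2 * (K + 1))"])
    then have "\<forall>\<^sub>F c in at d. norm (R c - R d) \<le> cmod (c - d) * (2 * norm (R d) * K)"
    proof eventually_elim
      case (elim c)
      have le: "norm (R c - R d) \<le> cmod (c - d) * (norm (R c) * K)"
        using norm_resolvent_diff_le[of c d] by (simp add: K_def mult.assoc)
      have "cmod (c - d) * K \<le> 1 / (2 * (K + 1)) * K"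
        using elim K by (intro mult_right_mono) auto
      also have "\<dots> \<le> 1 / 2" using K by (simp add: field_simps)
      finally have "norm (R c) * (cmod (c - d) * K) \<le> norm (R c) * (1 / 2)"
        by (intro mult_left_mono) auto
      then have "norm (R c) \<le> 2 * norm (R d)"
        using le norm_triangle_ineq2[of "R c" "R d"] by (simp add: mult_ac)
      then have "cmod (c - d) * (norm (R c) * K) \<le> cmod (c - d) * (2 * norm (R d) * K)"
        using K by (intro mult_left_mono mult_right_mono) auto
      with le show ?case by linarith
    qed
    moreover have "((\<lambda>c. cmod (c - d) * (2 * norm (R d) * K)) \<longlongrightarrow> 0) (at d)"
      by (auto intro!: tendsto_eq_intros)
    ultimately have "((\<lambda>c. R c - R d) \<longlongrightarrow> 0) (at d)"
      by (rule Lim_null_comparison)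
    then show ?thesis by (simp add: LIM_zero_iff)
  qed
  then show ?thesis
    by (auto simp: continuous_on_eq_continuous_at[OF open_UNIV] isCont_def
        intro!: continuous_on_subset[of UNIV R S])
qed

definition average :: "nat \<Rightarrow> real \<Rightarrow> 'a" where
  "average m r = (1 / real m) *\<^sub>R (\<Sum>j<m. R (of_real r * cis (2 * pi * real j / real m)))"

text \<open>The average of the resolvent over the \<open>m\<close>-th roots of unity times \<open>r\<close> inverts \<open>1 - r\<^sup>m q\<^sup>m\<close>: multiplying
  a single resolvent by \<open>1 - (c q)\<^sup>m\<close> leaves a geometric sum, and averaging removes all powers
  of \<open>q\<close> but the constant one.\<close>

lemma average_inverse:
  assumes "m > 0"
  shows "(1 - (r ^ m) *\<^sub>R q ^ m) * average m r = 1"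
proof -
  define w where "w j = cis (2 * pi * real j / real m)" for j
  have w_mult: "w j ^ i = w i ^ j" for i j
    unfolding w_def Complex.DeMoivre by (rule arg_cong[of _ _ cis]) (simp add: mult_ac)
  have w_root: "w j ^ m = 1" for j
    using assms by (simp add: w_def Complex.DeMoivre)
  have inj: "inj_on w {..<m}"
    using Complex.bij_betw_roots_unity[OF assms] by (simp add: w_def[abs_def] bij_betw_def)
  have roots_sum: "(\<Sum>j<m. w j ^ i) = (if i = 0 then of_nat m else 0)" if "i < m" for i
  proof (cases "i = 0")
    case False
    then have "w i \<noteq> w 0" using inj that assms by (auto simp: inj_on_eq_iff)
    then have "w i \<noteq> 1" by (simp add: w_def)
    then have "(\<Sum>j<m. w i ^ j) = 0"
      by (simp add: geometric_sum w_root)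
    then show ?thesis using False by (simp add: w_mult)
  qed simp
  have "(1 - (r ^ m) *\<^sub>R q ^ m) * R (of_real r * w j) = (\<Sum>i<m. (of_real r * w j) ^ i *\<^sub>C q ^ i)" for j
  proof -
    let ?c = "of_real r * w j"
    have "(r ^ m) *\<^sub>R q ^ m = (?c *\<^sub>C q) ^ m"
      by (simp add: scaleC_power power_mult_distrib w_root flip: scaleC_of_real)
    then have "(1 - (r ^ m) *\<^sub>R q ^ m) * R ?c = (\<Sum>i<m. (?c *\<^sub>C q) ^ i) * ((1 - ?c *\<^sub>C q) * R ?c)"
      by (simp only: geometric_sum_mult mult.assoc flip: mult.assoc[of _ "1 - ?c *\<^sub>C q"])
    then show ?thesis by (simp add: right_inverse scaleC_power)
  qed
  then have "(1 - (r ^ m) *\<^sub>R q ^ m) * (\<Sum>j<m. R (of_real r * w j))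
      = (\<Sum>j<m. \<Sum>i<m. (of_real r * w j) ^ i *\<^sub>C q ^ i)"
    by (simp add: sum_distrib_left)
  also have "\<dots> = (\<Sum>i<m. \<Sum>j<m. (of_real r * w j) ^ i *\<^sub>C q ^ i)"
    by (rule sum.swap)
  also have "\<dots> = (\<Sum>i<m. (of_real r ^ i * (\<Sum>j<m. w j ^ i)) *\<^sub>C q ^ i)"
    by (simp add: power_mult_distrib sum_distrib_left scaleC_sum_left)
  also have "\<dots> = (\<Sum>i<m. if i = 0 then of_nat m *\<^sub>C 1 else 0)"
    by (intro sum.cong) (auto simp: roots_sum scaleC_zero_left)
  also have "\<dots> = real m *\<^sub>R 1"
    using assms scaleC_of_real[of "real m" "1::'a"] by simp
  finally show ?thesis
    using assms by (simp add: average_def w_def)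
qed

text \<open>The averages at \<open>r\<close> and at a slightly larger \<open>s\<close> are close, uniformly in \<open>m\<close>, because the resolvent is
  Lipschitz on discs. If \<open>r\<^sup>m q\<^sup>m\<close> tends to \<open>0\<close>, then the averages at \<open>r\<close> tend to \<open>1\<close>, so those at \<open>s\<close>
  are near \<open>1\<close>, and this bounds \<open>s\<^sup>m q\<^sup>m\<close>. Giving up half of the gap between \<open>r\<close> and \<open>s\<close> turns the
  bound into convergence to \<open>0\<close>.\<close>

lemma power_tendsto_zero_step:
  assumes M: "\<And>c. cmod c \<le> L + 1 \<Longrightarrow> norm (R c) \<le> M"
    and \<delta>: "0 < \<delta>" "2 * \<delta> \<le> 1" "2 * \<delta> * (M * norm q * M) \<le> 1 / 3"
    and r: "0 \<le> r" "r \<le> L"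
    and lim: "(\<lambda>m. r ^ m * norm (q ^ m)) \<longlonglongrightarrow> 0"
  shows "(\<lambda>m. (r + \<delta>) ^ m * norm (q ^ m)) \<longlonglongrightarrow> 0"
proof -
  have "norm (R 0) \<le> M" using r by (intro M) auto
  then have M0: "M \<ge> 0" using norm_ge_zero[of "R 0"] by linarith
  let ?s = "r + 2 * \<delta>"
  \<comment> \<open>The averages at \<open>s\<close> and at \<open>r\<close> differ by at most \<open>1/3\<close>; those at \<open>r\<close> come within \<open>1/6\<close> of \<open>1\<close>.\<close>
  have near: "norm (R (of_real ?s * z) - R (of_real r * z)) \<le> 1 / 3" if "cmod z = 1" for z
  proof -
    have n: "norm (R (of_real ?s * z)) \<le> M" "norm (R (of_real r * z)) \<le> M"
      using r \<delta> that by (auto intro!: M simp: norm_mult simp flip: of_real_add of_real_mult)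
    have "of_real ?s * z - of_real r * z = of_real (2 * \<delta>) * z" by (simp add: algebra_simps)
    then have d: "cmod (of_real ?s * z - of_real r * z) = 2 * \<delta>"
      using that \<delta> by (simp add: norm_mult)
    have "norm (R (of_real ?s * z) - R (of_real r * z)) \<le> 2 * \<delta> * (M * norm q * M)"
      using n M0 \<delta> by (intro order.trans[OF norm_resolvent_diff_le] mult_mono) (auto simp: d simp del: of_real_add of_real_mult)
    with \<delta> show ?thesis by linarith
  qed
  have bound: "norm (average m r) \<le> M" if "m > 0" for m
  proof -
    have "norm (\<Sum>j<m. R (of_real r * cis (2 * pi * real j / real m))) \<le> (\<Sum>j<m. M)"
      using r by (intro sum_norm_le M) (auto simp: norm_mult)
    then show ?thesis using that by (simp add: average_def field_simps)
  qed
  have diff: "norm (average m ?s - average m r) \<le> 1 / 3" if "m > 0" for m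
  proof -
    have "norm (\<Sum>j<m. R (of_real ?s * cis (2 * pi * real j / real m))
        - R (of_real r * cis (2 * pi * real j / real m))) \<le> (\<Sum>j<m. 1 / 3)"
      by (intro sum_norm_le near) auto
    then have "norm ((1 / real m) *\<^sub>R (\<Sum>j<m. R (of_real ?s * cis (2 * pi * real j / real m))
        - R (of_real r * cis (2 * pi * real j / real m)))) \<le> 1 / 3"
      using that by (simp add: field_simps)
    then show ?thesis
      by (simp add: average_def sum_subtractf scaleR_diff_right)
  qed
  have "(\<lambda>m. r ^ m * norm (q ^ m) * M) \<longlonglongrightarrow> 0"
    using tendsto_mult_right[OF lim, of M] by simp
  then have "\<forall>\<^sub>F m in sequentially. r ^ m * norm (q ^ m) * M < 1 / 6"
    by (rule order_tendstoD) auto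
  then have "\<forall>\<^sub>F m in sequentially. ?s ^ m * norm (q ^ m) \<le> 1"
    using eventually_gt_at_top[of 0]
  proof eventually_elim
    case (elim m)
    have one: "average m t - 1 = (t ^ m) *\<^sub>R q ^ m * average m t" for t
      using average_inverse[OF elim(2), of t] by (simp add: algebra_simps)
    have "norm (average m r - 1) \<le> r ^ m * norm (q ^ m) * M"
      unfolding one using r bound[OF elim(2)]
      by (intro order.trans[OF norm_mult_ineq] mult_mono) auto
    with elim(1) diff[OF elim(2)] norm_triangle_ineq[of "average m ?s - average m r" "average m r - 1"]
    have half: "norm (average m ?s - 1) \<le> 1 / 2" by simp
    let ?Q = "(?s ^ m) *\<^sub>R q ^ m"
    \<comment> \<open>If \<open>V\<close> inverts \<open>1 - Q\<close> and is near \<open>1\<close>, then \<open>Q\<close> is bounded.\<close>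
    have "norm Q \<le> norm (V - 1) + norm Q * norm (V - 1)" if "V - 1 = Q * V" for Q V :: 'a
    proof -
      have "(V - 1) - Q * (V - 1) = (V - 1) - (Q * V - Q)"
        by (simp only: right_diff_distrib mult_1_right)
      with that have "Q = (V - 1) - Q * (V - 1)" by simp
      then have "norm Q \<le> norm (V - 1) + norm (Q * (V - 1))"
        using norm_triangle_ineq4[of "V - 1" "Q * (V - 1)"] by simp
      with norm_mult_ineq[of Q "V - 1"] show ?thesis by linarith
    qed
    from this[OF one] have "norm ?Q \<le> norm (average m ?s - 1) + norm ?Q * norm (average m ?s - 1)" .
    also have "\<dots> \<le> 1 / 2 + norm ?Q * (1 / 2)"
      using half by (intro add_mono mult_left_mono) auto
    finally show ?case using r \<delta> by simp
  qed
  then have "\<forall>\<^sub>F m in sequentially. norm ((r + \<delta>) ^ m * norm (q ^ m)) \<le> ((r + \<delta>) / ?s) ^ m"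
  proof eventually_elim
    case (elim m)
    have "?s > 0" using r \<delta> by simp
    then have "(r + \<delta>) ^ m * norm (q ^ m) = ((r + \<delta>) / ?s) ^ m * (?s ^ m * norm (q ^ m))"
      by (simp add: power_divide)
    also have "\<dots> \<le> ((r + \<delta>) / ?s) ^ m * 1"
      using elim r \<delta> by (intro mult_left_mono) auto
    finally show ?case using r \<delta> by simp
  qed
  moreover have "(\<lambda>m. ((r + \<delta>) / ?s) ^ m) \<longlonglongrightarrow> 0"
    using r \<delta> by (intro LIMSEQ_power_zero) (simp add: field_simps)
  ultimately show ?thesis by (rule Lim_null_comparison)
qed

text \<open>The step length depends only on a bound for the resolvent on one disc, so finitely many steps
  lead from \<open>0\<close> to \<open>L\<close>.\<close>

lemma power_tendsto_zero:
  assumes "L \<ge> 0"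
  shows "(\<lambda>m. L ^ m * norm (q ^ m)) \<longlonglongrightarrow> 0"
proof -
  have "bounded (R ` cball 0 (L + 1))"
    by (intro compact_imp_bounded compact_continuous_image continuous_resolvent) auto
  then obtain M where M: "\<And>c. cmod c \<le> L + 1 \<Longrightarrow> norm (R c) \<le> M"
    unfolding bounded_iff by fastforce
  have "norm (R 0) \<le> M" using assms by (intro M) auto
  then have M0: "M \<ge> 0" using norm_ge_zero[of "R 0"] by linarith
  define \<delta> where "\<delta> = 1 / (6 * (M * norm q * M + 1))"
  have \<delta>: "0 < \<delta>" "2 * \<delta> \<le> 1" "2 * \<delta> * (M * norm q * M) \<le> 1 / 3"
    using M0 by (auto simp: \<delta>_def field_simps add_pos_nonneg)
  have steps: "(\<lambda>m. (real k * \<delta>) ^ m * norm (q ^ m)) \<longlonglongrightarrow> 0" if "real k * \<delta> \<le> L + \<delta>" for k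
    using that
  proof (induction k)
    case 0
    show ?case by (rule tendsto_eventually) (auto intro: eventually_mono[OF eventually_gt_at_top[of 0]])
  next
    case (Suc k)
    then have "real k * \<delta> \<le> L" using \<delta> by (simp add: algebra_simps)
    moreover from this have "(\<lambda>m. (real k * \<delta>) ^ m * norm (q ^ m)) \<longlonglongrightarrow> 0"
      using \<delta> by (intro Suc.IH) auto
    ultimately have "(\<lambda>m. (real k * \<delta> + \<delta>) ^ m * norm (q ^ m)) \<longlonglongrightarrow> 0"
      using \<delta> by (intro power_tendsto_zero_step[OF M \<delta>]) auto
    then show ?case by (simp add: algebra_simps)
  qed
  define k where "k = nat \<lceil>L / \<delta>\<rceil>"
  have "real k = of_int \<lceil>L / \<delta>\<rceil>" using assms \<delta> by (simp add: k_def)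
  then have "L / \<delta> \<le> real k" "real k \<le> L / \<delta> + 1" by linarith+
  then have k: "L \<le> real k * \<delta>" "real k * \<delta> \<le> L + \<delta>"
    using \<delta> by (simp_all add: field_simps)
  show ?thesis
  proof (rule Lim_null_comparison[OF _ steps[OF k(2)]])
    show "\<forall>\<^sub>F m in sequentially. norm (L ^ m * norm (q ^ m)) \<le> (real k * \<delta>) ^ m * norm (q ^ m)"
      using assms k(1) by (auto intro!: always_eventually mult_right_mono power_mono)
  qed
qed

end

text \<open>The case of the spectral radius formula that is needed: spectrum \<open>{0}\<close> forces spectral radius \<open>0\<close>.\<close>

lemma spectrum_zero_power_bound:
  fixes q :: "'a::complex_banach_algebra_1"
  assumes sp: "spectrum q = {0}" and "\<epsilon> > 0"
  obtains m where "m > 0" "norm (q ^ m) < \<epsilon> ^ m"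
proof -
  have "\<exists>v. (1 - c *\<^sub>C q) * v = 1 \<and> v * (1 - c *\<^sub>C q) = 1" for c
  proof (cases "c = 0")
    case False
    then have "inverse c \<notin> spectrum q" using sp by auto
    then obtain v where v: "(inverse c *\<^sub>C 1 - q) * v = 1" "v * (inverse c *\<^sub>C 1 - q) = 1"
      by (auto simp: spectrum_def)
    have "1 - c *\<^sub>C q = c *\<^sub>C (inverse c *\<^sub>C 1 - q)"
      using False by (simp add: scaleC_diff scaleC_scaleC scaleC_one)
    then have "(1 - c *\<^sub>C q) * (inverse c *\<^sub>C v) = 1 \<and> (inverse c *\<^sub>C v) * (1 - c *\<^sub>C q) = 1"
      using False by (simp add: mult_scaleC_left mult_scaleC_right scaleC_scaleC scaleC_one v)
    then show ?thesis by blast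
  next
    case True
    then show ?thesis by (intro exI[of _ 1]) (simp add: scaleC_zero_left)
  qed
  then obtain R where "\<And>c. (1 - c *\<^sub>C q) * R c = 1 \<and> R c * (1 - c *\<^sub>C q) = 1"
    by metis
  then interpret quasinilpotent_resolvent q R by unfold_locales auto
  have "(\<lambda>m. (1 / \<epsilon>) ^ m * norm (q ^ m)) \<longlonglongrightarrow> 0"
    using \<open>\<epsilon> > 0\<close> by (intro power_tendsto_zero) auto
  then have "\<forall>\<^sub>F m in sequentially. (1 / \<epsilon>) ^ m * norm (q ^ m) < 1 \<and> m > 0"
    by (intro eventually_conj order_tendstoD(2) eventually_gt_at_top) auto
  then obtain m where "(1 / \<epsilon>) ^ m * norm (q ^ m) < 1" "m > 0"
    using eventually_happens'[OF sequentially_bot] by blast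
  then show thesis
    using \<open>\<epsilon> > 0\<close> by (intro that[of m]) (auto simp: field_simps power_divide)
qed

section \<open>Convergence of Newton's iteration\<close>

text \<open>The element \<open>q\<close> to be made small has small powers, but its own norm may be large. The weighted norm
  \<open>sup\<^sub>m \<parallel>q\<^sup>m z\<parallel> / \<epsilon>\<^sup>m\<close> repairs this: multiplication by \<open>q\<close> has operator norm at most \<open>\<epsilon>\<close> for it, while
  elements commuting with \<open>q\<close> act with no more than their original norm. The predicate says that
  multiplication by \<open>w\<close> has operator norm at most \<open>c\<close>; quantifying over the bounds \<open>K\<close> avoids
  forming the supremum.\<close>

definition damped :: "'a::real_normed_algebra_1 \<Rightarrow> real \<Rightarrow> 'a \<Rightarrow> real \<Rightarrow> bool" where
  "damped q \<epsilon> w c \<longleftrightarrow> (\<forall>z K. (\<forall>m. norm (q ^ m * z) \<le> K * \<epsilon> ^ m) \<longrightarrow>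
     (\<forall>m. norm (q ^ m * (w * z)) \<le> c * K * \<epsilon> ^ m))"

lemma dampedD:
  "damped q \<epsilon> w c \<Longrightarrow> (\<And>m. norm (q ^ m * z) \<le> K * \<epsilon> ^ m) \<Longrightarrow> norm (q ^ m * (w * z)) \<le> c * K * \<epsilon> ^ m"
  unfolding damped_def by blast

lemma damped_add:
  assumes "damped q \<epsilon> v c" "damped q \<epsilon> w d"
  shows "damped q \<epsilon> (v + w) (c + d)"
  unfolding damped_def
proof (intro allI impI)
  fix z K m assume "\<forall>m. norm (q ^ m * z) \<le> K * \<epsilon> ^ m"
  then have "norm (q ^ m * (v * z)) \<le> c * K * \<epsilon> ^ m" "norm (q ^ m * (w * z)) \<le> d * K * \<epsilon> ^ m"
    using assms by (auto intro: dampedD)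
  then show "norm (q ^ m * ((v + w) * z)) \<le> (c + d) * K * \<epsilon> ^ m"
    using norm_triangle_ineq[of "q ^ m * (v * z)" "q ^ m * (w * z)"] by (simp add: distrib_left distrib_right)
qed

lemma damped_mult:
  assumes "damped q \<epsilon> v c" "damped q \<epsilon> w d"
  shows "damped q \<epsilon> (v * w) (c * d)"
  unfolding damped_def
proof (intro allI impI)
  fix z K m assume "\<forall>m. norm (q ^ m * z) \<le> K * \<epsilon> ^ m"
  then have "norm (q ^ m * (w * z)) \<le> (d * K) * \<epsilon> ^ m" for m
    using assms(2) by (auto intro: dampedD)
  then have "norm (q ^ m * (v * (w * z))) \<le> c * (d * K) * \<epsilon> ^ m"
    by (rule dampedD[OF assms(1)])
  then show "norm (q ^ m * (v * w * z)) \<le> c * d * K * \<epsilon> ^ m" by (simp add: mult.assoc)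
qed

lemma damped_scaleR:
  assumes "damped q \<epsilon> w c"
  shows "damped q \<epsilon> (r *\<^sub>R w) (\<bar>r\<bar> * c)"
  unfolding damped_def
proof (intro allI impI)
  fix z K m assume "\<forall>m. norm (q ^ m * z) \<le> K * \<epsilon> ^ m"
  then have "norm (q ^ m * (w * z)) \<le> c * K * \<epsilon> ^ m" using assms by (auto intro: dampedD)
  from mult_left_mono[OF this, of "\<bar>r\<bar>"]
  show "norm (q ^ m * (r *\<^sub>R w * z)) \<le> \<bar>r\<bar> * c * K * \<epsilon> ^ m" by (simp add: mult.assoc)
qed

lemma damped_mono:
  assumes "damped q \<epsilon> w c" "c \<le> d" "\<epsilon> > 0"
  shows "damped q \<epsilon> w d"
  unfolding damped_def
proof (intro allI impI)
  fix z K m assume *: "\<forall>m. norm (q ^ m * z) \<le> K * \<epsilon> ^ m"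
  have "norm z \<le> K" using spec[OF *, of 0] by simp
  then have "K \<ge> 0" using norm_ge_zero[of z] by linarith
  then have "c * (K * \<epsilon> ^ m) \<le> d * (K * \<epsilon> ^ m)" using assms by (intro mult_right_mono) auto
  then show "norm (q ^ m * (w * z)) \<le> d * K * \<epsilon> ^ m"
    using dampedD[OF assms(1), of z K m] * by (simp add: mult.assoc)
qed

lemma damped_one: "damped q \<epsilon> 1 1"
  by (simp add: damped_def)

lemma damped_commute:
  assumes "w * q = q * w"
  shows "damped q \<epsilon> w (norm w)"
  unfolding damped_def
proof (intro allI impI)
  fix z K m assume "\<forall>m. norm (q ^ m * z) \<le> K * \<epsilon> ^ m"
  then have "norm w * norm (q ^ m * z) \<le> norm w * (K * \<epsilon> ^ m)" by (intro mult_left_mono) auto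
  moreover have "q ^ m * (w * z) = w * (q ^ m * z)"
    using power_commuting_commutes[OF assms[symmetric]] by (simp flip: mult.assoc)
  ultimately show "norm (q ^ m * (w * z)) \<le> norm w * K * \<epsilon> ^ m"
    using norm_mult_ineq[of w "q ^ m * z"] by (simp add: mult.assoc)
qed

lemma damped_self: "damped q \<epsilon> q \<epsilon>"
  unfolding damped_def
proof (intro allI impI)
  fix z K m assume "\<forall>m. norm (q ^ m * z) \<le> K * \<epsilon> ^ m"
  from spec[OF this, of "Suc m"] show "norm (q ^ m * (q * z)) \<le> \<epsilon> * K * \<epsilon> ^ m"
    by (simp add: mult_ac power_commutes flip: mult.assoc)
qed

text \<open>Operator bounds for the weighted norm control the original norm, by testing on \<open>1\<close>.\<close>

lemma damped_norm_le:
  assumes "damped q \<epsilon> w c" and "\<And>m. norm (q ^ m) \<le> C * \<epsilon> ^ m"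
  shows "norm w \<le> c * C"
proof -
  have "norm (q ^ 0 * (w * 1)) \<le> c * C * \<epsilon> ^ 0"
    by (rule dampedD[OF assms(1)]) (simp add: assms(2))
  then show ?thesis by simp
qed

text \<open>The bound \<open>B\<close> depends only on \<open>p\<close> and \<open>r\<close>, not on \<open>q\<close> and \<open>\<epsilon>\<close>. This uniformity lets \<open>\<epsilon>\<close> be chosen
  afterwards.\<close>

lemma damped_poly_alg:
  assumes "r \<ge> 0"
  obtains B where "B \<ge> 0" "\<And>(q :: 'a::real_normed_algebra_1) \<epsilon> y. damped q \<epsilon> y r \<Longrightarrow> damped q \<epsilon> (poly_alg p y) B"
proof -
  have "\<exists>B\<ge>0. \<forall>(q :: 'a) \<epsilon> y. damped q \<epsilon> y r \<longrightarrow> damped q \<epsilon> (poly_alg p y) B"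
  proof (induction p)
    case 0
    show ?case by (auto simp: damped_def intro!: exI[of _ 0])
  next
    case (pCons c p)
    then obtain B where "B \<ge> 0" and B: "\<And>(q :: 'a) \<epsilon> y. damped q \<epsilon> y r \<Longrightarrow> damped q \<epsilon> (poly_alg p y) B"
      by blast
    have "damped q \<epsilon> (poly_alg (pCons c p) y) (\<bar>c\<bar> * 1 + r * B)" if "damped q \<epsilon> y r" for q y :: 'a and \<epsilon>
      unfolding poly_alg_pCons
      by (intro damped_add damped_scaleR damped_one damped_mult that B)
    then show ?case using assms \<open>B \<ge> 0\<close> by (intro exI[of _ "\<bar>c\<bar> * 1 + r * B"]) auto
  qed
  then show thesis using that by blast
qed

text \<open>Exponents are divided by \<open>n\<close>; the finitely many remainders are absorbed in the constant.\<close>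

lemma norm_power_bound_from_one:
  fixes q :: "'a::real_normed_algebra_1"
  assumes "n > 0" "norm (q ^ n) \<le> \<epsilon> ^ n" "\<epsilon> > 0"
  obtains C where "\<And>m. norm (q ^ m) \<le> C * \<epsilon> ^ m"
proof
  fix m
  let ?C = "\<Sum>i<n. norm (q ^ i) / \<epsilon> ^ i"
  have "norm (q ^ (m mod n)) / \<epsilon> ^ (m mod n) \<le> ?C"
    using assms by (intro member_le_sum) auto
  then have le: "norm (q ^ (m mod n)) \<le> ?C * \<epsilon> ^ (m mod n)" using assms by (simp add: field_simps)
  have "q ^ m = (q ^ n) ^ (m div n) * q ^ (m mod n)"
    by (simp flip: power_mult power_add)
  then have "norm (q ^ m) = norm ((q ^ n) ^ (m div n) * q ^ (m mod n))"
    by (rule arg_cong)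
  also have "\<dots> \<le> norm (q ^ n) ^ (m div n) * norm (q ^ (m mod n))"
    by (intro order.trans[OF norm_mult_ineq] mult_right_mono norm_power_ineq norm_ge_zero)
  also have "\<dots> \<le> (\<epsilon> ^ n) ^ (m div n) * (?C * \<epsilon> ^ (m mod n))"
    using assms le by (intro mult_mono power_mono) auto
  also have "\<dots> = ?C * (\<epsilon> ^ (n * (m div n)) * \<epsilon> ^ (m mod n))" by (simp add: power_mult)
  also have "\<epsilon> ^ (n * (m div n)) * \<epsilon> ^ (m mod n) = \<epsilon> ^ m" by (simp flip: power_add)
  finally show "norm (q ^ m) \<le> ?C * \<epsilon> ^ m" .
qed

text \<open>The threshold \<open>\<epsilon>\<close> for \<open>p(x)\<close> depends on \<open>x\<close> only through a bound \<open>R\<close> for its norm, and only a single power of \<open>p(x)\<close> has to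
  meet it. In the weighted norm belonging to \<open>q = p(x)\<close> the starting error is \<open>\<epsilon>\<close>, and the usual
  estimates for Newton's iteration apply.\<close>

lemma newton_converges:
  fixes R :: real
  assumes u: "p dvd u * pderiv p - 1" and "R \<ge> 0"
  obtains \<epsilon> where "\<epsilon> > 0"
    "\<And>(x :: 'a::{real_normed_algebra_1, banach}) n. norm x \<le> R \<Longrightarrow> n > 0 \<Longrightarrow> norm (poly_alg p x ^ n) \<le> \<epsilon> ^ n \<Longrightarrow>
      \<exists>a. (\<lambda>k. (newton_step p u ^^ k) x) \<longlonglongrightarrow> a \<and> poly_alg p a = 0"
proof -
  obtain g where g: "\<And>y :: 'a. poly_alg p (newton_step p u y) = poly_alg p y * poly_alg p y * poly_alg g y"
    using newton_step_quadratic[OF u] by blast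
  obtain U where U0: "U \<ge> 0" and U: "\<And>(q :: 'a) \<epsilon> y. damped q \<epsilon> y (R + 1) \<Longrightarrow> damped q \<epsilon> (poly_alg u y) U"
    using damped_poly_alg[of "R + 1" u] \<open>R \<ge> 0\<close> by (metis add_nonneg_nonneg zero_le_one)
  obtain B where B0: "B \<ge> 0" and B: "\<And>(q :: 'a) \<epsilon> y. damped q \<epsilon> y (R + 1) \<Longrightarrow> damped q \<epsilon> (poly_alg g y) B"
    using damped_poly_alg[of "R + 1" g] \<open>R \<ge> 0\<close> by (metis add_nonneg_nonneg zero_le_one)
  \<comment> \<open>The bound on \<open>\<epsilon> U\<close> keeps all iterates bounded by \<open>R + 1\<close>, where \<open>U\<close> and \<open>B\<close> are valid;
    the bound on \<open>\<epsilon> B\<close> halves the error in every step.\<close>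
  define \<epsilon> where "\<epsilon> = 1 / (2 * (U + B + 1))"
  have \<epsilon>: "\<epsilon> > 0" "\<epsilon> * U \<le> 1 / 2" "\<epsilon> * B \<le> 1 / 2"
    using U0 B0 by (auto simp: \<epsilon>_def field_simps)
  show thesis
  proof (rule that[OF \<epsilon>(1)])
    fix x :: 'a and n
    assume x: "norm x \<le> R" and "n > 0" "norm (poly_alg p x ^ n) \<le> \<epsilon> ^ n"
    define q where "q = poly_alg p x"
    obtain C where C: "\<And>m. norm (q ^ m) \<le> C * \<epsilon> ^ m"
      using norm_power_bound_from_one[of n q \<epsilon>] \<open>n > 0\<close> \<open>norm (poly_alg p x ^ n) \<le> \<epsilon> ^ n\<close> \<epsilon>(1)
      unfolding q_def by blast
    define y where "y k = (newton_step p u ^^ k) x" for k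
    have y_Suc: "y (Suc k) = y k + (- 1) *\<^sub>R (poly_alg p (y k) * poly_alg u (y k))" for k
      by (simp add: y_def newton_step_def)
    have inv: "damped q \<epsilon> (y k) (R + 1 - (1 / 2) ^ k) \<and> damped q \<epsilon> (poly_alg p (y k)) (\<epsilon> * (1 / 2) ^ k)" for k
    proof (induction k)
      case 0
      have "x * q = q * x"
        using poly_alg_mult[of "[:0, 1:]" p x] poly_alg_mult[of p "[:0, 1:]" x]
        unfolding q_def by (simp only: poly_alg_X mult.commute)
      from damped_mono[OF damped_commute[OF this]] show ?case
        using x \<epsilon>(1) damped_self[of q \<epsilon>] by (simp add: y_def q_def)
    next
      case (Suc k)
      then have yk: "damped q \<epsilon> (y k) (R + 1 - (1 / 2) ^ k)" and pk: "damped q \<epsilon> (poly_alg p (y k)) (\<epsilon> * (1 / 2) ^ k)"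
        by auto
      have yk': "damped q \<epsilon> (y k) (R + 1)" by (rule damped_mono[OF yk _ \<epsilon>(1)]) simp
      have "damped q \<epsilon> (y (Suc k)) ((R + 1 - (1 / 2) ^ k) + \<bar>- 1\<bar> * (\<epsilon> * (1 / 2) ^ k * U))"
        unfolding y_Suc by (intro damped_add damped_scaleR damped_mult yk pk U yk')
      moreover have "(R + 1 - (1 / 2) ^ k) + \<bar>- 1\<bar> * (\<epsilon> * (1 / 2) ^ k * U) \<le> R + 1 - (1 / 2) ^ Suc k"
      proof -
        have "\<epsilon> * (1 / 2) ^ k * U = \<epsilon> * U * (1 / 2) ^ k" by (simp only: mult_ac)
        also have "\<dots> \<le> 1 / 2 * (1 / 2) ^ k" using \<epsilon>(2) by (intro mult_right_mono) auto
        finally show ?thesis unfolding power_Suc abs_minus_cancel abs_one mult_1_left by linarith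
      qed
      ultimately have 1: "damped q \<epsilon> (y (Suc k)) (R + 1 - (1 / 2) ^ Suc k)"
        by (rule damped_mono[OF _ _ \<epsilon>(1)])
      have "poly_alg p (y (Suc k)) = poly_alg p (y k) * poly_alg p (y k) * poly_alg g (y k)"
        using g[of "y k"] by (simp add: y_def)
      then have "damped q \<epsilon> (poly_alg p (y (Suc k))) (\<epsilon> * (1 / 2) ^ k * (\<epsilon> * (1 / 2) ^ k) * B)"
        by (simp only:) (intro damped_mult pk B yk')
      moreover have "\<epsilon> * (1 / 2) ^ k * (\<epsilon> * (1 / 2) ^ k) * B \<le> \<epsilon> * (1 / 2) ^ Suc k"
      proof -
        have "(1 / 2) ^ k * (\<epsilon> * B) \<le> 1 * (1 / 2 :: real)"
          using \<epsilon> B0 by (intro mult_mono power_le_one) auto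
        from mult_left_mono[OF this, of "\<epsilon> * (1 / 2) ^ k"] show ?thesis using \<epsilon>(1) by (simp add: mult_ac)
      qed
      ultimately have 2: "damped q \<epsilon> (poly_alg p (y (Suc k))) (\<epsilon> * (1 / 2) ^ Suc k)"
        by (rule damped_mono[OF _ _ \<epsilon>(1)])
      from 1 2 show ?case ..
    qed
    have "norm (y (Suc k) - y k) \<le> (\<epsilon> * U * C) * (1 / 2) ^ k" for k
    proof -
      have "damped q \<epsilon> (poly_alg u (y k)) U"
        using inv[of k] by (intro U damped_mono[OF conjunct1[OF inv[of k]] _ \<epsilon>(1)]) simp
      with inv[of k] have "damped q \<epsilon> (poly_alg p (y k) * poly_alg u (y k)) (\<epsilon> * (1 / 2) ^ k * U)"
        by (intro damped_mult) auto
      from damped_norm_le[OF this C] show ?thesis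
        unfolding y_Suc by (simp add: mult_ac)
    qed
    moreover have geo: "summable (\<lambda>k. (\<epsilon> * U * C) * (1 / 2) ^ k)"
      by (intro summable_mult summable_geometric) simp
    ultimately have "summable (\<lambda>k. y (Suc k) - y k)"
      by (intro summable_comparison_test'[OF geo, where N = 0]) auto
    then have "convergent (\<lambda>k. \<Sum>i<k. y (Suc i) - y i)"
      by (simp add: summable_iff_convergent)
    then have "convergent (\<lambda>k. (\<Sum>i<k. y (Suc i) - y i) + y 0)"
      by (intro convergent_add convergent_const)
    then obtain a where a: "y \<longlonglongrightarrow> a"
      by (auto simp: sum_lessThan_telescope convergent_def)
    have "(\<lambda>k. poly_alg p (y k)) \<longlonglongrightarrow> 0"
    proof (rule Lim_null_comparison)
      show "\<forall>\<^sub>F k in sequentially. norm (poly_alg p (y k)) \<le> \<epsilon> * C * (1 / 2) ^ k"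
        using damped_norm_le[OF conjunct2[OF inv] C] by (simp add: mult_ac)
      show "(\<lambda>k. \<epsilon> * C * (1 / 2) ^ k) \<longlonglongrightarrow> 0"
        by (intro tendsto_mult_right_zero LIMSEQ_power_zero) simp
    qed
    moreover have "(\<lambda>k. poly_alg p (y k)) \<longlonglongrightarrow> poly_alg p a"
      using continuous_on_poly_alg[of UNIV p] a
      by (auto simp: continuous_on_eq_continuous_at isCont_def intro!: isCont_tendsto_compose[of a])
    ultimately have "poly_alg p a = 0" by (rule LIMSEQ_unique[symmetric])
    with a show "\<exists>a. (\<lambda>k. (newton_step p u ^^ k) x) \<longlonglongrightarrow> a \<and> poly_alg p a = 0"
      unfolding y_def by blast
  qed
qed

section \<open>The Banach algebra of absolutely convergent power series\<close>

text \<open>Power series with absolutely summable coefficients, i.e. absolutely convergent on the closed unit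
  disc, with the Cauchy product and the sum of the norms of the coefficients as norm. Other radii
  of convergence are reached by rescaling the variable.\<close>

typedef (overloaded) 'a disc_series =
  "{f :: 'a::real_normed_algebra_1 fps. summable (\<lambda>n. norm (fps_nth f n))}"
  morphisms fps_of_disc_series Abs_disc_series
  by (rule exI[of _ 0]) simp

setup_lifting type_definition_disc_series

lemma summable_norm_fps_mult:
  fixes f g :: "'a::real_normed_algebra_1 fps"
  assumes f: "summable (\<lambda>n. norm (fps_nth f n))" and g: "summable (\<lambda>n. norm (fps_nth g n))"
  shows "summable (\<lambda>n. norm (fps_nth (f * g) n))"
    and "(\<Sum>n. norm (fps_nth (f * g) n)) \<le> (\<Sum>n. norm (fps_nth f n)) * (\<Sum>n. norm (fps_nth g n))"
proof -
  have C: "(\<lambda>k. \<Sum>i\<le>k. norm (fps_nth f i) * norm (fps_nth g (k - i)))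
      sums ((\<Sum>n. norm (fps_nth f n)) * (\<Sum>n. norm (fps_nth g n)))"
    using f g by (intro Cauchy_product_sums) auto
  have le: "norm (fps_nth (f * g) k) \<le> (\<Sum>i\<le>k. norm (fps_nth f i) * norm (fps_nth g (k - i)))" for k
    unfolding fps_mult_nth atMost_atLeast0
    by (intro sum_norm_le norm_mult_ineq)
  show S: "summable (\<lambda>n. norm (fps_nth (f * g) n))"
    by (rule summable_comparison_test'[OF sums_summable[OF C], where N = 0])
      (unfold real_norm_def abs_norm_cancel, rule le)
  show "(\<Sum>n. norm (fps_nth (f * g) n)) \<le> (\<Sum>n. norm (fps_nth f n)) * (\<Sum>n. norm (fps_nth g n))"
    unfolding sums_unique[OF C] by (rule suminf_le[OF le S sums_summable[OF C]])
qed

instantiation disc_series :: (real_normed_algebra_1) real_normed_algebra_1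
begin

lift_definition zero_disc_series :: "'a disc_series" is 0 by simp

lift_definition one_disc_series :: "'a disc_series" is 1
  by (rule summable_finite[of "{0}"]) auto

lift_definition plus_disc_series :: "'a disc_series \<Rightarrow> 'a disc_series \<Rightarrow> 'a disc_series" is "(+)"
  subgoal for f g
    by (rule summable_comparison_test'[where N = 0,
          OF summable_add[of "\<lambda>n. norm (fps_nth f n)" "\<lambda>n. norm (fps_nth g n)"]])
      (auto intro: norm_triangle_ineq)
  done

lift_definition minus_disc_series :: "'a disc_series \<Rightarrow> 'a disc_series \<Rightarrow> 'a disc_series" is "(-)"
  subgoal for f g
    by (rule summable_comparison_test'[where N = 0,
          OF summable_add[of "\<lambda>n. norm (fps_nth f n)" "\<lambda>n. norm (fps_nth g n)"]])
      (auto intro: norm_triangle_ineq4)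
  done

lift_definition uminus_disc_series :: "'a disc_series \<Rightarrow> 'a disc_series" is uminus
  by simp

lift_definition times_disc_series :: "'a disc_series \<Rightarrow> 'a disc_series \<Rightarrow> 'a disc_series" is "(*)"
  by (rule summable_norm_fps_mult)

lift_definition scaleR_disc_series :: "real \<Rightarrow> 'a disc_series \<Rightarrow> 'a disc_series"
  is "\<lambda>r f. Abs_fps (\<lambda>n. r *\<^sub>R fps_nth f n)"
  by (auto intro: summable_mult)

lift_definition norm_disc_series :: "'a disc_series \<Rightarrow> real" is "\<lambda>f. \<Sum>n. norm (fps_nth f n)" .

definition dist_disc_series :: "'a disc_series \<Rightarrow> 'a disc_series \<Rightarrow> real"
  where "dist_disc_series f g = norm (f - g)"

definition sgn_disc_series :: "'a disc_series \<Rightarrow> 'a disc_series"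
  where "sgn_disc_series f = inverse (norm f) *\<^sub>R f"

definition [code del]:
  "(uniformity :: ('a disc_series \<times> 'a disc_series) filter) =
     (INF e\<in>{0 <..}. principal {(f, g). dist f g < e})"

definition open_disc_series :: "'a disc_series set \<Rightarrow> bool"
  where [code del]: "open_disc_series S =
    (\<forall>x\<in>S. \<forall>\<^sub>F (x', y) in uniformity. x' = x \<longrightarrow> y \<in> S)"

instance
proof
  fix f g h :: "'a disc_series" and r s :: real
  show "f + g + h = f + (g + h)" by transfer (rule add.assoc)
  show "f + g = g + f" by transfer (rule add.commute)
  show "0 + f = f" by transfer simp
  show "- f + f = 0" by transfer simp
  show "f - g = f + - g" by transfer simp
  show "r *\<^sub>R (f + g) = r *\<^sub>R f + r *\<^sub>R g" by transfer (simp add: fps_eq_iff scaleR_add_right)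
  show "(r + s) *\<^sub>R f = r *\<^sub>R f + s *\<^sub>R f" by transfer (simp add: fps_eq_iff scaleR_add_left)
  show "r *\<^sub>R s *\<^sub>R f = (r * s) *\<^sub>R f" by transfer (simp add: fps_eq_iff)
  show "1 *\<^sub>R f = f" by transfer (simp add: fps_eq_iff)
  show "f * g * h = f * (g * h)" by transfer (rule mult.assoc)
  show "(f + g) * h = f * h + g * h" by transfer (rule distrib_right)
  show "f * (g + h) = f * g + f * h" by transfer (rule distrib_left)
  show "r *\<^sub>R f * g = r *\<^sub>R (f * g)"
    by transfer (simp add: fps_eq_iff fps_mult_nth scaleR_sum_right)
  show "f * r *\<^sub>R g = r *\<^sub>R (f * g)"
    by transfer (simp add: fps_eq_iff fps_mult_nth scaleR_sum_right)
  show "1 * f = f" by transfer simp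
  show "f * 1 = f" by transfer simp
  show "(0 :: 'a disc_series) \<noteq> 1" by transfer simp
  show "dist f g = norm (f - g)" by (rule dist_disc_series_def)
  show "sgn f = inverse (norm f) *\<^sub>R f" by (rule sgn_disc_series_def)
  show "(uniformity :: ('a disc_series \<times> 'a disc_series) filter) =
     (INF e\<in>{0 <..}. principal {(f, g). dist f g < e})"
    by (rule uniformity_disc_series_def)
  show "open S = (\<forall>x\<in>S. \<forall>\<^sub>F (x', y) in uniformity. x' = x \<longrightarrow> y \<in> S)"
    for S :: "'a disc_series set"
    by (rule open_disc_series_def)
  show "(norm f = 0) = (f = 0)"
    by transfer (simp add: suminf_eq_zero_iff fps_eq_iff)
  show "norm (f + g) \<le> norm f + norm g"
  proof transfer
    fix f g :: "'a fps"
    assume fg: "summable (\<lambda>n. norm (fps_nth f n))" "summable (\<lambda>n. norm (fps_nth g n))"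
    have "(\<Sum>n. norm (fps_nth (f + g) n)) \<le> (\<Sum>n. norm (fps_nth f n) + norm (fps_nth g n))"
      using fg by (intro suminf_le summable_add summable_comparison_test'[OF summable_add[OF fg], where N = 0])
        (auto intro: norm_triangle_ineq)
    then show "(\<Sum>n. norm (fps_nth (f + g) n)) \<le> (\<Sum>n. norm (fps_nth f n)) + (\<Sum>n. norm (fps_nth g n))"
      using fg by (simp add: suminf_add)
  qed
  show "norm (r *\<^sub>R f) = \<bar>r\<bar> * norm f"
    by transfer (simp add: suminf_mult)
  show "norm (f * g) \<le> norm f * norm g"
    by transfer (rule summable_norm_fps_mult)
  show "norm (1 :: 'a disc_series) = 1"
  proof transfer
    have "(\<lambda>n. norm (fps_nth (1 :: 'a fps) n)) sums (\<Sum>n\<in>{0}. norm (fps_nth (1 :: 'a fps) n))"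
      by (rule sums_finite) auto
    then show "(\<Sum>n. norm (fps_nth (1 :: 'a fps) n)) = 1" by (simp add: sums_iff)
  qed
qed

end

lift_definition disc_coeff :: "'a::real_normed_algebra_1 disc_series \<Rightarrow> nat \<Rightarrow> 'a" is fps_nth .

lemma disc_series_eqI: "(\<And>n. disc_coeff f n = disc_coeff g n) \<Longrightarrow> f = g"
  by transfer (simp add: fps_eq_iff)

lemma disc_coeff_simps:
  "disc_coeff 0 n = 0"
  "disc_coeff 1 n = (if n = 0 then 1 else 0)"
  "disc_coeff (f + g) n = disc_coeff f n + disc_coeff g n"
  "disc_coeff (f - g) n = disc_coeff f n - disc_coeff g n"
  "disc_coeff (r *\<^sub>R f) n = r *\<^sub>R disc_coeff f n"
  "disc_coeff (f * g) n = (\<Sum>i\<le>n. disc_coeff f i * disc_coeff g (n - i))"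
  by (transfer; simp add: fps_mult_nth atMost_atLeast0)+

lemma summable_norm_disc_coeff: "summable (\<lambda>n. norm (disc_coeff f n))"
  by transfer

lemma norm_disc_series_eq: "norm f = (\<Sum>n. norm (disc_coeff f n))"
  by transfer simp

lemma norm_disc_series_le:
  assumes "\<And>N. (\<Sum>n<N. norm (disc_coeff f n)) \<le> M"
  shows "norm f \<le> M"
  unfolding norm_disc_series_eq using assms by (intro suminf_le_const summable_norm_disc_coeff)

lemma sum_norm_disc_coeff_le: "(\<Sum>n<N. norm (disc_coeff f n)) \<le> norm f"
  unfolding norm_disc_series_eq by (intro sum_le_suminf summable_norm_disc_coeff) auto

lemma norm_disc_coeff_le: "norm (disc_coeff f n) \<le> norm f"
  using sum_norm_disc_coeff_le[of f "Suc n"] sum_nonneg[of "{..<n}" "\<lambda>n. norm (disc_coeff f n)"]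
  by simp

definition disc_series_of :: "(nat \<Rightarrow> 'a::real_normed_algebra_1) \<Rightarrow> 'a disc_series" where
  "disc_series_of c = Abs_disc_series (Abs_fps c)"

lemma disc_coeff_disc_series_of:
  assumes "summable (\<lambda>n. norm (c n))"
  shows "disc_coeff (disc_series_of c) = c"
  using assms unfolding disc_series_of_def disc_coeff_def
  by (simp add: Abs_disc_series_inverse fun_eq_iff)

text \<open>The limit of a Cauchy sequence is taken coefficient by coefficient. Bounds for the partial sums of
  \<open>\<parallel>X i - X j\<parallel>\<close> survive the limit in \<open>j\<close>, which makes the convergence one in norm.\<close>

instance disc_series :: ("{real_normed_algebra_1, banach}") banach
proof
  fix X :: "nat \<Rightarrow> 'a disc_series"
  assume X: "Cauchy X"
  define L where "L n = lim (\<lambda>k. disc_coeff (X k) n)" for n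
  have L: "(\<lambda>k. disc_coeff (X k) n) \<longlonglongrightarrow> L n" for n
  proof -
    have "Cauchy (\<lambda>k. disc_coeff (X k) n)"
      unfolding Cauchy_def dist_norm
    proof (intro allI impI)
      fix e :: real assume "e > 0"
      then obtain M where M: "\<forall>i\<ge>M. \<forall>j\<ge>M. norm (X i - X j) < e"
        using X by (auto simp: Cauchy_def dist_norm)
      show "\<exists>M. \<forall>i\<ge>M. \<forall>j\<ge>M. norm (disc_coeff (X i) n - disc_coeff (X j) n) < e"
        using M norm_disc_coeff_le[of "X _ - X _" n] by (metis disc_coeff_simps(4) order.strict_trans1)
    qed
    then show ?thesis
      unfolding L_def using Cauchy_convergent convergent_LIMSEQ_iff by blast
  qed
  have tail: "\<exists>M. \<forall>i\<ge>M. \<forall>N. (\<Sum>n<N. norm (disc_coeff (X i) n - L n)) \<le> e" if "e > 0" for e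
  proof -
    obtain M where M: "\<forall>i\<ge>M. \<forall>j\<ge>M. norm (X i - X j) < e"
      using X \<open>e > 0\<close> by (auto simp: Cauchy_def dist_norm)
    have "(\<Sum>n<N. norm (disc_coeff (X i) n - L n)) \<le> e" if "i \<ge> M" for i N
    proof (rule Lim_bounded)
      show "(\<lambda>j. \<Sum>n<N. norm (disc_coeff (X i) n - disc_coeff (X j) n))
          \<longlonglongrightarrow> (\<Sum>n<N. norm (disc_coeff (X i) n - L n))"
        by (intro tendsto_intros L)
      show "\<forall>j\<ge>M. (\<Sum>n<N. norm (disc_coeff (X i) n - disc_coeff (X j) n)) \<le> e"
      proof (intro allI impI)
        fix j assume "j \<ge> M"
        then have "norm (X i - X j) \<le> e" using M that by (auto intro: less_imp_le)
        with sum_norm_disc_coeff_le[of "X i - X j" N]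
        show "(\<Sum>n<N. norm (disc_coeff (X i) n - disc_coeff (X j) n)) \<le> e"
          by (simp add: disc_coeff_simps)
      qed
    qed
    then show ?thesis by blast
  qed
  have "summable (\<lambda>n. norm (L n))"
  proof -
    obtain M where M: "\<And>N. (\<Sum>n<N. norm (disc_coeff (X M) n - L n)) \<le> 1"
      using tail[of 1] by auto
    have "summable (\<lambda>n. norm (disc_coeff (X M) n - L n))"
      using M by (intro summableI_nonneg_bounded[where x = 1]) auto
    from summable_add[OF this summable_norm_disc_coeff[of "X M"]] show ?thesis
      by (rule summable_comparison_test'[where N = 0])
        (use norm_triangle_sub[of "L _" "disc_coeff (X M) _"] in \<open>simp add: norm_minus_commute add.commute\<close>)
  qed
  then have coeff: "disc_coeff (disc_series_of L) = L" by (rule disc_coeff_disc_series_of)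
  have "X \<longlonglongrightarrow> disc_series_of L"
  proof (rule metric_LIMSEQ_I)
    fix e :: real assume "e > 0"
    then obtain M where M: "\<forall>i\<ge>M. \<forall>N. (\<Sum>n<N. norm (disc_coeff (X i) n - L n)) \<le> e / 2"
      using tail[of "e / 2"] by auto
    have "dist (X i) (disc_series_of L) < e" if "i \<ge> M" for i
    proof -
      have "norm (X i - disc_series_of L) \<le> e / 2"
        using M that by (intro norm_disc_series_le) (simp add: disc_coeff_simps coeff)
      then show ?thesis using \<open>e > 0\<close> by (simp add: dist_norm)
    qed
    then show "\<exists>M. \<forall>i\<ge>M. dist (X i) (disc_series_of L) < e" by blast
  qed
  then show "convergent X" by (auto simp: convergent_def)
qed

definition disc_eval :: "'a::{real_normed_algebra_1, banach} disc_series \<Rightarrow> real \<Rightarrow> 'a" where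
  "disc_eval f s = (\<Sum>k. s ^ k *\<^sub>R disc_coeff f k)"

lemma disc_eval_term_le: "\<bar>s\<bar> \<le> 1 \<Longrightarrow> norm (s ^ k *\<^sub>R disc_coeff f k) \<le> norm (disc_coeff f k)"
  using mult_right_mono[OF power_le_one[of "\<bar>s\<bar>" k], of "norm (disc_coeff f k)"] by (simp add: power_abs)

lemma summable_norm_disc_eval:
  "\<bar>s\<bar> \<le> 1 \<Longrightarrow> summable (\<lambda>k. norm (s ^ k *\<^sub>R disc_coeff f k))"
  by (rule summable_comparison_test'[OF summable_norm_disc_coeff[of f], where N = 0])
    (use disc_eval_term_le in auto)

lemma disc_eval_sums:
  assumes "\<bar>s\<bar> \<le> 1"
  shows "(\<lambda>k. s ^ k *\<^sub>R disc_coeff f k) sums disc_eval f s"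
  unfolding disc_eval_def by (intro summable_sums summable_norm_cancel[OF summable_norm_disc_eval[OF assms]])

lemma norm_disc_eval_le:
  assumes "\<bar>s\<bar> \<le> 1"
  shows "norm (disc_eval f s) \<le> norm f"
  unfolding disc_eval_def norm_disc_series_eq
  by (intro order.trans[OF summable_norm] suminf_le summable_norm_disc_eval assms
      disc_eval_term_le summable_norm_disc_coeff)

text \<open>Evaluation at a point of the disc is a unital homomorphism, multiplicative by Mertens' theorem on
  Cauchy products. This is what transports Newton's iteration from series to values.\<close>

lemma disc_eval_hom:
  fixes f g :: "'a::{real_normed_algebra_1, banach} disc_series"
  assumes "\<bar>s\<bar> \<le> 1"
  shows "disc_eval (f + g) s = disc_eval f s + disc_eval g s"
    and "disc_eval (r *\<^sub>R f) s = r *\<^sub>R disc_eval f s"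
    and "disc_eval (f * g) s = disc_eval f s * disc_eval g s"
    and "disc_eval 1 s = (1 :: 'a)"
proof -
  show "disc_eval (f + g) s = disc_eval f s + disc_eval g s"
    using sums_add[OF disc_eval_sums[OF assms, of f] disc_eval_sums[OF assms, of g]]
    by (simp add: disc_eval_def[of "f + g"] disc_coeff_simps scaleR_add_right sums_iff)
  show "disc_eval (r *\<^sub>R f) s = r *\<^sub>R disc_eval f s"
    using sums_scaleR_right[OF disc_eval_sums[OF assms, of f], of r]
    by (simp add: disc_eval_def[of "r *\<^sub>R f"] disc_coeff_simps sums_iff mult.commute)
  have "(\<lambda>k. \<Sum>i\<le>k. (s ^ i *\<^sub>R disc_coeff f i) * (s ^ (k - i) *\<^sub>R disc_coeff g (k - i)))
      sums (disc_eval f s * disc_eval g s)"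
    unfolding disc_eval_def by (intro Cauchy_product_sums summable_norm_disc_eval assms)
  moreover have "(\<Sum>i\<le>k. (s ^ i *\<^sub>R disc_coeff f i) * (s ^ (k - i) *\<^sub>R disc_coeff g (k - i)))
      = s ^ k *\<^sub>R disc_coeff (f * g) k" for k
    unfolding disc_coeff_simps scaleR_sum_right
    by (intro sum.cong) (auto simp: mult.commute simp flip: power_add)
  ultimately show "disc_eval (f * g) s = disc_eval f s * disc_eval g s"
    by (simp add: disc_eval_def[of "f * g"] sums_iff)
  have "(\<lambda>k. s ^ k *\<^sub>R disc_coeff 1 k) sums (\<Sum>k\<in>{0}. s ^ k *\<^sub>R disc_coeff (1 :: 'a disc_series) k)"
    by (rule sums_finite) (auto simp: disc_coeff_simps)
  then show "disc_eval 1 s = (1 :: 'a)" by (simp add: disc_eval_def sums_iff disc_coeff_simps)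
qed

lemma tendsto_disc_eval:
  assumes "X \<longlonglongrightarrow> f" "\<bar>s\<bar> \<le> 1"
  shows "(\<lambda>k. disc_eval (X k) s) \<longlonglongrightarrow> disc_eval f s"
proof -
  have "bounded_linear (\<lambda>f. disc_eval f s)"
    using assms norm_disc_eval_le[of s] by (intro bounded_linear_intro[where K = 1]) (auto simp: disc_eval_hom)
  then show ?thesis using assms(1) by (rule bounded_linear.tendsto)
qed

text \<open>The substitution of \<open>\<rho> t\<close> for the variable \<open>t\<close>.\<close>

definition dilate :: "real \<Rightarrow> 'a::real_normed_algebra_1 disc_series \<Rightarrow> 'a disc_series" where
  "dilate \<rho> f = disc_series_of (\<lambda>k. \<rho> ^ k *\<^sub>R disc_coeff f k)"

lemma disc_coeff_dilate:
  assumes "0 \<le> \<rho>" "\<rho> \<le> 1"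
  shows "disc_coeff (dilate \<rho> f) k = \<rho> ^ k *\<^sub>R disc_coeff f k"
proof -
  have "summable (\<lambda>k. norm (\<rho> ^ k *\<^sub>R disc_coeff f k))"
    using assms by (intro summable_comparison_test'[OF summable_norm_disc_coeff[of f], where N = 0])
      (auto simp: power_le_one mult_left_le_one_le)
  then show ?thesis unfolding dilate_def by (simp add: disc_coeff_disc_series_of)
qed

lemma dilate_hom:
  fixes f g :: "'a::real_normed_algebra_1 disc_series"
  assumes "0 \<le> \<rho>" "\<rho> \<le> 1"
  shows "dilate \<rho> (f + g) = dilate \<rho> f + dilate \<rho> g"
    and "dilate \<rho> (r *\<^sub>R f) = r *\<^sub>R dilate \<rho> f"
    and "dilate \<rho> (f * g) = dilate \<rho> f * dilate \<rho> g"
    and "dilate \<rho> 1 = (1 :: 'a disc_series)"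
proof -
  show "dilate \<rho> (f + g) = dilate \<rho> f + dilate \<rho> g" "dilate \<rho> (r *\<^sub>R f) = r *\<^sub>R dilate \<rho> f" "dilate \<rho> 1 = (1 :: 'a disc_series)"
    by (auto intro!: disc_series_eqI simp: disc_coeff_simps disc_coeff_dilate[OF assms] scaleR_add_right mult.commute)
  show "dilate \<rho> (f * g) = dilate \<rho> f * dilate \<rho> g"
    by (intro disc_series_eqI)
      (auto simp: disc_coeff_simps disc_coeff_dilate[OF assms] scaleR_sum_right mult.commute
        intro!: sum.cong simp flip: power_add)
qed

lemma dilate_power:
  assumes "0 \<le> \<rho>" "\<rho> \<le> 1"
  shows "dilate \<rho> (f ^ m) = dilate \<rho> f ^ m"
  by (induction m) (auto simp: dilate_hom assms)

text \<open>As \<open>\<rho>\<close> tends to \<open>0\<close>, only the constant term survives in the norm. Through this bound a smallness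
  condition at the centre carries over to a whole neighbourhood.\<close>

lemma norm_dilate_le:
  assumes "0 \<le> \<rho>" "\<rho> \<le> 1"
  shows "norm (dilate \<rho> f) \<le> norm (disc_coeff f 0) + \<rho> * norm f"
proof (rule norm_disc_series_le)
  fix N
  have "norm (disc_coeff (dilate \<rho> f) k) \<le> (if k = 0 then norm (disc_coeff f 0) else 0) + \<rho> * norm (disc_coeff f k)" for k
    using assms power_decreasing[of 1 k \<rho>]
    by (cases "k = 0") (auto simp: disc_coeff_dilate intro!: mult_right_mono)
  then have "(\<Sum>k<N. norm (disc_coeff (dilate \<rho> f) k))
      \<le> (\<Sum>k<N. (if k = 0 then norm (disc_coeff f 0) else 0) + \<rho> * norm (disc_coeff f k))"
    by (rule sum_mono)
  also have "\<dots> = (if N = 0 then 0 else norm (disc_coeff f 0)) + \<rho> * (\<Sum>k<N. norm (disc_coeff f k))"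
    by (simp add: sum.distrib sum_distrib_left)
  also have "\<dots> \<le> norm (disc_coeff f 0) + \<rho> * norm f"
    using assms by (intro add_mono mult_left_mono sum_norm_disc_coeff_le) auto
  finally show "(\<Sum>k<N. norm (disc_coeff (dilate \<rho> f) k)) \<le> norm (disc_coeff f 0) + \<rho> * norm f" .
qed

lemma disc_eval_dilate:
  assumes "0 \<le> \<rho>" "\<rho> \<le> 1"
  shows "disc_eval (dilate \<rho> f) s = disc_eval f (\<rho> * s)"
  by (simp add: disc_eval_def disc_coeff_dilate[OF assms] power_mult_distrib mult.commute)

lemma disc_coeff_0_hom:
  "disc_coeff (f + g) 0 = disc_coeff f 0 + disc_coeff g 0"
  "disc_coeff (r *\<^sub>R f) 0 = r *\<^sub>R disc_coeff f 0"
  "disc_coeff (f * g) 0 = disc_coeff f 0 * disc_coeff g 0"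
  "disc_coeff 1 0 = 1"
  by (simp_all add: disc_coeff_simps)

text \<open>Dilation is a homomorphism, so \<open>p(x)\<^sup>m\<close> may be computed before dilating; its constant term is the
  \<open>m\<close>-th power of a quasinilpotent element and hence small for suitable \<open>m\<close>.\<close>

lemma newton_converges_disc_series:
  fixes x :: "'a::{complex_banach_algebra_1} disc_series"
  assumes u: "p dvd u * pderiv p - 1" and sp: "spectrum (poly_alg p (disc_coeff x 0)) = {0}"
  obtains \<rho> a where "0 < \<rho>" "\<rho> \<le> 1" "(\<lambda>k. (newton_step p u ^^ k) (dilate \<rho> x)) \<longlonglongrightarrow> a" "poly_alg p a = 0"
proof -
  obtain \<epsilon> where "\<epsilon> > 0" and \<epsilon>: "\<And>(y :: 'a disc_series) n. norm y \<le> norm (disc_coeff x 0) + 1 \<Longrightarrow> n > 0 \<Longrightarrow>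
      norm (poly_alg p y ^ n) \<le> \<epsilon> ^ n \<Longrightarrow>
      \<exists>a. (\<lambda>k. (newton_step p u ^^ k) y) \<longlonglongrightarrow> a \<and> poly_alg p a = 0"
    using newton_converges[OF u, of "norm (disc_coeff x 0) + 1"] by (metis add_nonneg_nonneg norm_ge_zero zero_le_one)
  obtain m where "m > 0" and m: "norm (poly_alg p (disc_coeff x 0) ^ m) < \<epsilon> ^ m"
    using spectrum_zero_power_bound[OF sp \<open>\<epsilon> > 0\<close>] by blast
  define w where "w = poly_alg p x ^ m"
  have coeff_0: "disc_coeff (poly_alg p x) 0 = poly_alg p (disc_coeff x 0)"
    by (rule poly_alg_hom[of "\<lambda>f. disc_coeff f 0"]) (rule disc_coeff_0_hom)+
  have "disc_coeff (poly_alg p x ^ k) 0 = poly_alg p (disc_coeff x 0) ^ k" for k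
    by (induction k) (simp_all add: disc_coeff_0_hom coeff_0)
  then have w0: "norm (disc_coeff w 0) < \<epsilon> ^ m" using m by (simp add: w_def)
  \<comment> \<open>Any sufficiently small \<open>\<rho>\<close> meets the norm bound and the smallness condition at once.\<close>
  have "((\<lambda>\<rho>. \<rho> * norm x) \<longlongrightarrow> 0) (at_right 0)" "((\<lambda>\<rho>. norm (disc_coeff w 0) + \<rho> * norm w) \<longlongrightarrow> norm (disc_coeff w 0)) (at_right 0)"
    by (auto intro!: tendsto_eq_intros)
  then have "\<forall>\<^sub>F \<rho> in at_right 0. \<rho> * norm x < 1" "\<forall>\<^sub>F \<rho> in at_right 0. norm (disc_coeff w 0) + \<rho> * norm w < \<epsilon> ^ m"
    using w0 by (auto intro: order_tendstoD)
  moreover have "\<forall>\<^sub>F \<rho> in at_right (0 :: real). \<rho> \<in> {0<..<1}"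
    by (rule eventually_at_right_real) simp
  ultimately have "\<forall>\<^sub>F \<rho> in at_right 0. \<rho> * norm x < 1 \<and> norm (disc_coeff w 0) + \<rho> * norm w < \<epsilon> ^ m \<and> \<rho> \<in> {0<..<1}"
    by eventually_elim auto
  then obtain \<rho> where \<rho>: "\<rho> * norm x < 1" "norm (disc_coeff w 0) + \<rho> * norm w < \<epsilon> ^ m" "0 < \<rho>" "\<rho> < 1"
    using eventually_happens'[OF trivial_limit_at_right_real] by force
  have "norm (dilate \<rho> x) \<le> norm (disc_coeff x 0) + 1"
    using norm_dilate_le[of \<rho> x] \<rho> by simp
  moreover have "poly_alg p (dilate \<rho> x) ^ m = dilate \<rho> w"
  proof -
    have "dilate \<rho> (poly_alg p x) = poly_alg p (dilate \<rho> x)"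
      by (rule poly_alg_hom[of "dilate \<rho>"]) (use \<rho> in \<open>simp_all add: dilate_hom\<close>)
    then show ?thesis using \<rho> by (simp add: w_def dilate_power)
  qed
  then have "norm (poly_alg p (dilate \<rho> x) ^ m) \<le> \<epsilon> ^ m"
    using norm_dilate_le[of \<rho> w] \<rho> by simp
  ultimately obtain a where "(\<lambda>k. (newton_step p u ^^ k) (dilate \<rho> x)) \<longlonglongrightarrow> a" "poly_alg p a = 0"
    using \<epsilon> \<open>m > 0\<close> by blast
  with \<rho> show thesis by (intro that[of \<rho> a]) auto
qed

section \<open>Rearrangement of power series\<close>

text \<open>A double series that converges absolutely when summed along diagonals may be summed by rows instead.
  Recentring a power series and multiplying two of them are both instances.\<close>

lemma sums_diagonals:
  fixes F :: "nat \<Rightarrow> nat \<Rightarrow> 'a::banach"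
  assumes diag: "summable (\<lambda>k. \<Sum>i\<le>k. norm (F i (k - i)))"
  obtains S where "(\<lambda>k. \<Sum>i\<le>k. F i (k - i)) sums S" "(\<lambda>j. \<Sum>i. F i j) sums S"
    "\<And>j. summable (\<lambda>i. norm (F i j))"
proof -
  have reindex: "(f has_sum S) (SIGMA k:UNIV. {..k}) \<longleftrightarrow> ((\<lambda>(j, i). f (i + j, i)) has_sum S) (UNIV \<times> UNIV)"
    for f :: "nat \<times> nat \<Rightarrow> 'c::{comm_monoid_add, topological_space}" and S
    by (rule has_sum_reindex_bij_witness[where i = "\<lambda>(j, i). (i + j, i)" and j = "\<lambda>(k, i). (k - i, i)"])
      auto
  have "(\<lambda>k. \<Sum>i\<le>k. norm (F i (k - i))) summable_on UNIV"
    using diag by (intro norm_summable_imp_summable_on) (simp add: sum_nonneg)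
  then have "(\<lambda>(k, i). norm (F i (k - i))) summable_on (SIGMA k:UNIV. {..k})"
    by (intro summable_on_SigmaI[where g = "\<lambda>k. \<Sum>i\<le>k. norm (F i (k - i))"])
      (auto intro!: has_sum_finite)
  then have prod: "(\<lambda>(j, i). norm (F i j)) summable_on UNIV \<times> UNIV"
    unfolding summable_on_def reindex by simp
  from prod have abs: "(\<lambda>(j, i). F i j) abs_summable_on UNIV \<times> UNIV"
    by (simp add: case_prod_unfold)
  have rows: "summable (\<lambda>i. norm (F i j))" for j
    using summable_on_SigmaD1[OF prod, of j] by (auto intro: summable_on_imp_summable)
  obtain S where S: "((\<lambda>(j, i). F i j) has_sum S) (UNIV \<times> UNIV)"
    using abs_summable_summable[OF abs] unfolding summable_on_def by blast
  have "((\<lambda>j. \<Sum>i. F i j) has_sum S) UNIV"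
  proof (rule has_sum_SigmaD[OF S])
    show "((\<lambda>i. case (j, i) of (j, i) \<Rightarrow> F i j) has_sum (\<Sum>i. F i j)) UNIV" for j
      using rows[of j] summable_norm_cancel[OF rows[of j]] by (auto intro!: norm_summable_imp_has_sum)
  qed
  then have 1: "(\<lambda>j. \<Sum>i. F i j) sums S" by (rule has_sum_imp_sums)
  have "((\<lambda>(k, i). F i (k - i)) has_sum S) (SIGMA k:UNIV. {..k})"
    unfolding reindex using S by simp
  then have "((\<lambda>k. \<Sum>i\<le>k. F i (k - i)) has_sum S) UNIV"
    by (rule has_sum_SigmaD) (auto intro!: has_sum_finite)
  then have 2: "(\<lambda>k. \<Sum>i\<le>k. F i (k - i)) sums S" by (rule has_sum_imp_sums)
  from that[OF 2 1 rows] show thesis .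
qed

text \<open>With \<open>x = x0 + (x - x0)\<close>, the binomial expansions of the terms \<open>x\<^sup>k c k\<close> are the diagonals of a double
  series whose rows collect the powers of \<open>x - x0\<close>.\<close>

lemma real_analytic_on_power_series:
  fixes c :: "nat \<Rightarrow> 'a::banach"
  assumes c: "summable (\<lambda>k. r ^ k * norm (c k))"
  shows "(\<lambda>x. \<Sum>k. x ^ k *\<^sub>R c k) real_analytic_on {-r<..<r}"
  unfolding real_analytic_on_def
proof (intro ballI exI conjI impI allI)
  fix x0 assume x0: "x0 \<in> {-r<..<r}"
  then show "r - \<bar>x0\<bar> > 0" by auto
  fix x assume "\<bar>x - x0\<bar> < r - \<bar>x0\<bar>"
  then have le: "\<bar>x0\<bar> + \<bar>x - x0\<bar> \<le> r" by simp
  define F where "F i j = (x - x0) ^ j *\<^sub>R (of_nat (i + j choose i) * x0 ^ i) *\<^sub>R c (i + j)" for i j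
  have diag: "(\<Sum>i\<le>k. F i (k - i)) = x ^ k *\<^sub>R c k" for k
  proof -
    have "(\<Sum>i\<le>k. F i (k - i)) = (\<Sum>i\<le>k. of_nat (k choose i) * x0 ^ i * (x - x0) ^ (k - i)) *\<^sub>R c k"
      unfolding scaleR_sum_left by (intro sum.cong) (auto simp: F_def mult_ac)
    then show ?thesis by (simp flip: binomial_ring)
  qed
  have norm_diag: "(\<Sum>i\<le>k. norm (F i (k - i))) = (\<bar>x0\<bar> + \<bar>x - x0\<bar>) ^ k * norm (c k)" for k
    unfolding binomial_ring sum_distrib_right
    by (intro sum.cong) (auto simp: F_def abs_mult power_abs mult_ac)
  have "summable (\<lambda>k. \<Sum>i\<le>k. norm (F i (k - i)))"
    unfolding norm_diag using le
    by (intro summable_comparison_test'[OF c, where N = 0])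
      (auto intro!: mult_right_mono power_mono)
  then obtain S where S: "(\<lambda>k. \<Sum>i\<le>k. F i (k - i)) sums S" "(\<lambda>j. \<Sum>i. F i j) sums S"
    and rows: "\<And>j. summable (\<lambda>i. norm (F i j))"
    using sums_diagonals[of F] by blast
  have "(\<Sum>i. F i j) = (x - x0) ^ j *\<^sub>R (\<Sum>i. (of_nat (i + j choose i) * x0 ^ i) *\<^sub>R c (i + j))" for j
  proof (cases "x = x0")
    case True
    then show ?thesis by (cases j) (auto simp: F_def)
  next
    case False
    have "summable (\<lambda>i. (1 / (x - x0) ^ j) *\<^sub>R F i j)"
      by (intro summable_scaleR_right summable_norm_cancel[OF rows])
    then have "summable (\<lambda>i. (of_nat (i + j choose i) * x0 ^ i) *\<^sub>R c (i + j))"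
      using False by (simp add: F_def)
    then show ?thesis
      unfolding F_def by (rule suminf_scaleR_right[symmetric])
  qed
  then show "(\<lambda>j. (x - x0) ^ j *\<^sub>R (\<Sum>i. (of_nat (i + j choose i) * x0 ^ i) *\<^sub>R c (i + j)))
      sums (\<Sum>k. x ^ k *\<^sub>R c k)"
    using S by (simp add: diag sums_iff)
qed

section \<open>Bounded lifting through a surjection\<close>

text \<open>The quantitative form of the open mapping theorem. By Baire's theorem the closure of the image of
  some ball contains a ball; so every \<open>y\<close> can be hit up to an error \<open>\<parallel>y\<parallel> / 2\<close> at a cost proportional to
  \<open>\<parallel>y\<parallel>\<close>, and correcting the error repeatedly gives a geometric series of corrections.\<close>

lemma surj_bounded_lift:
  fixes f :: "'a::banach \<Rightarrow> 'b::banach"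
  assumes f: "bounded_linear f" and surj: "surj f"
  obtains C where "C > 0" "\<And>y. \<exists>x. f x = y \<and> norm x \<le> C * norm y"
proof -
  interpret f: bounded_linear f by fact
  have "\<exists>n y e. e > 0 \<and> ball y e \<subseteq> closure (f ` ball 0 (real n))"
  proof (rule ccontr)
    assume *: "\<not> ?thesis"
    have "interior (\<Union>(range (\<lambda>n. closure (f ` ball 0 (real n))))) = {}"
      unfolding euclidean_interior_of[symmetric] mtopology_is_euclidean[symmetric]
    proof (rule Met_TC.metric_Baire_category_alt)
      show "Met_TC.mcomplete TYPE('b)" by (simp add: mcomplete_iff_complete complete_UNIV)
      fix T assume "T \<in> range (\<lambda>n. closure (f ` ball 0 (real n)))"
      then obtain n where T: "T = closure (f ` ball 0 (real n))" by auto
      have "interior T = {}"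
        using * unfolding T by (metis all_not_in_conv mem_interior)
      then show "closedin Met_TC.mtopology T \<and> Met_TC.mtopology interior_of T = {}"
        by (simp add: T)
    qed simp
    moreover have "(\<Union>n. closure (f ` ball 0 (real n))) = UNIV"
    proof -
      have "y \<in> (\<Union>n. closure (f ` ball 0 (real n)))" for y
      proof -
        obtain x where "y = f x" using surj by blast
        moreover obtain n where "norm x < real n" using reals_Archimedean2 by blast
        ultimately have "y \<in> f ` ball 0 (real n)" by simp
        then have "y \<in> closure (f ` ball 0 (real n))"
          by (rule subsetD[OF closure_subset])
        then show ?thesis by (rule UN_I[OF UNIV_I])
      qed
      then show ?thesis by blast
    qed
    ultimately show False by simp
  qed
  then obtain n y0 e where e: "e > 0" and sub: "ball y0 e \<subseteq> closure (f ` ball 0 (real n))" by blast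
  \<comment> \<open>Differences of points of the ball around \<open>y0\<close> fill a ball around \<open>0\<close>, at twice the cost.\<close>
  have approx: "\<exists>x. norm (y - f x) < \<delta> \<and> norm x \<le> 2 * real n" if "norm y < e" "\<delta> > 0" for y \<delta>
  proof -
    have "y0 + y \<in> closure (f ` ball 0 (real n))" "y0 \<in> closure (f ` ball 0 (real n))"
      using sub that e by (auto simp: dist_norm subset_iff)
    then have "\<exists>z\<in>f ` ball 0 (real n). dist z (y0 + y) < \<delta> / 2"
      "\<exists>z\<in>f ` ball 0 (real n). dist z y0 < \<delta> / 2"
      using \<open>\<delta> > 0\<close> unfolding closure_approachable by (meson half_gt_zero)+
    then obtain u v where "dist (f u) (y0 + y) < \<delta> / 2" "norm u < real n"
      "dist (f v) y0 < \<delta> / 2" "norm v < real n"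
      by auto
    moreover have "norm (y - f (u - v)) \<le> norm (f v - y0) + norm (f u - (y0 + y))"
    proof -
      have eq: "y - f (u - v) = (f v - y0) - (f u - (y0 + y))"
        by (simp add: f.diff)
      show ?thesis unfolding eq by (rule norm_triangle_ineq4)
    qed
    ultimately show ?thesis
      using norm_triangle_ineq4[of u v]
      by (intro exI[of _ "u - v"]) (auto simp: dist_norm)
  qed
  define K where "K = 4 * real n / e"
  have K0: "K \<ge> 0" using e by (simp add: K_def)
  \<comment> \<open>Rescaling \<open>y\<close> to norm \<open>e / 2\<close> makes the cost proportional to \<open>\<parallel>y\<parallel>\<close>.\<close>
  have half: "\<exists>x. norm (y - f x) \<le> norm y / 2 \<and> norm x \<le> K * norm y" for y
  proof (cases "y = 0")
    case False
    define t where "t = e / (2 * norm y)"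
    have t: "t > 0" using False e by (simp add: t_def)
    have "norm (t *\<^sub>R y) < e" using False e by (simp add: t_def)
    with t False obtain x where x: "norm (t *\<^sub>R y - f x) < t * (norm y / 2)" "norm x \<le> 2 * real n"
      using approx[of "t *\<^sub>R y" "t * (norm y / 2)"] by auto
    have "y - f (inverse t *\<^sub>R x) = inverse t *\<^sub>R (t *\<^sub>R y - f x)"
      using t by (simp add: f.scaleR scaleR_diff_right)
    then have "norm (y - f (inverse t *\<^sub>R x)) = inverse t * norm (t *\<^sub>R y - f x)"
      using t by simp
    also have "\<dots> \<le> inverse t * (t * (norm y / 2))"
      using x(1) t by (intro mult_left_mono) auto
    also have "\<dots> = norm y / 2" using t by (simp flip: mult.assoc)
    finally have 1: "norm (y - f (inverse t *\<^sub>R x)) \<le> norm y / 2" .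
    have "norm (inverse t *\<^sub>R x) = inverse t * norm x" using t by simp
    also have "\<dots> \<le> inverse t * (2 * real n)" using x(2) t by (intro mult_left_mono) auto
    also have "\<dots> = K * norm y" using False e by (simp add: t_def K_def field_simps)
    finally have "norm (inverse t *\<^sub>R x) \<le> K * norm y" .
    with 1 show ?thesis by blast
  next
    case True
    then show ?thesis by (intro exI[of _ 0]) simp
  qed
  then obtain g where g: "\<And>y. norm (y - f (g y)) \<le> norm y / 2" "\<And>y. norm (g y) \<le> K * norm y"
    by metis
  have lift: "\<exists>x. f x = y \<and> norm x \<le> 2 * K * norm y" for y
  proof -
    \<comment> \<open>The error that remains after \<open>k\<close> corrections.\<close>
    define r where "r k = ((\<lambda>z. z - f (g z)) ^^ k) y" for k
    have r_norm: "norm (r k) \<le> (1 / 2) ^ k * norm y" for k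
    proof (induction k)
      case (Suc k)
      have "norm (r (Suc k)) \<le> norm (r k) / 2" using g(1)[of "r k"] by (simp add: r_def)
      with Suc show ?case by simp
    qed (simp add: r_def)
    have g_norm: "norm (g (r k)) \<le> K * norm y * (1 / 2) ^ k" for k
    proof -
      have "norm (g (r k)) \<le> K * norm (r k)" by (rule g(2))
      also have "\<dots> \<le> K * ((1 / 2) ^ k * norm y)" by (intro mult_left_mono r_norm K0)
      finally show ?thesis by (simp only: mult_ac)
    qed
    have "(\<lambda>k. (1 / 2 :: real) ^ k) sums 2"
      using geometric_sums[of "1 / 2 :: real"] by simp
    then have geo: "(\<lambda>k. K * norm y * (1 / 2) ^ k) sums (K * norm y * 2)"
      by (rule sums_mult)
    have sm: "summable (\<lambda>k. norm (g (r k)))"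
      by (rule summable_comparison_test'[OF sums_summable[OF geo], where N = 0])
        (unfold real_norm_def abs_norm_cancel, rule g_norm)
    define x where "x = (\<Sum>k. g (r k))"
    have "norm x \<le> K * norm y * 2"
      unfolding x_def sums_unique[OF geo]
      by (rule order.trans[OF summable_norm[OF sm] suminf_le[OF g_norm sm sums_summable[OF geo]]])
    moreover have "f x = y"
    proof -
      have "(\<Sum>k<N. f (g (r k))) = y - r N" for N
        by (induction N) (auto simp: r_def)
      moreover have "r \<longlonglongrightarrow> 0"
      proof (rule Lim_null_comparison)
        show "\<forall>\<^sub>F k in sequentially. norm (r k) \<le> (1 / 2) ^ k * norm y"
          using r_norm by simp
        show "(\<lambda>k. (1 / 2) ^ k * norm y) \<longlonglongrightarrow> 0"
          by (auto intro!: tendsto_mult_left_zero LIMSEQ_power_zero)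
      qed
      ultimately have "(\<lambda>k. f (g (r k))) sums y"
        unfolding sums_def by (auto intro!: tendsto_eq_intros)
      moreover have "(\<lambda>k. f (g (r k))) sums f x"
        unfolding x_def by (intro f.sums summable_sums summable_norm_cancel[OF sm])
      ultimately show ?thesis by (simp add: sums_iff)
    qed
    ultimately show ?thesis by (auto simp: mult_ac)
  qed
  show thesis
  proof (rule that[of "2 * K + 1"])
    show "2 * K + 1 > 0" using K0 by simp
    show "\<exists>x. f x = y \<and> norm x \<le> (2 * K + 1) * norm y" for y
    proof -
      have le: "2 * K * norm y \<le> (2 * K + 1) * norm y" by (intro mult_right_mono) auto
      obtain x where x: "f x = y" "norm x \<le> 2 * K * norm y" using lift by blast
      show ?thesis using x(1) order.trans[OF x(2) le] by blast
    qed
  qed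
qed

section \<open>Analytic lifting through an analytic family of operators\<close>

lemma bounded_bilinear_cblinfun_apply:
  "bounded_bilinear (cblinfun_apply :: ('a::complex_normed_vector, 'b::complex_normed_vector) cblinfun \<Rightarrow> 'a \<Rightarrow> 'b)"
proof
  fix f g :: "('a, 'b) cblinfun" and x y :: 'a and r :: real
  show "cblinfun_apply (f + g) x = cblinfun_apply f x + cblinfun_apply g x"
    by transfer (rule blinfun.add_left)
  show "cblinfun_apply f (x + y) = cblinfun_apply f x + cblinfun_apply f y"
    by transfer (rule blinfun.add_right)
  show "cblinfun_apply (r *\<^sub>R f) x = r *\<^sub>R cblinfun_apply f x"
    by transfer (rule blinfun.scaleR_left)
  show "cblinfun_apply f (r *\<^sub>R x) = r *\<^sub>R cblinfun_apply f x"
    by transfer (rule blinfun.scaleR_right)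
  show "\<exists>K. \<forall>(f :: ('a, 'b) cblinfun) x. norm (cblinfun_apply f x) \<le> norm f * norm x * K"
    by (rule exI[of _ 1], transfer) (simp add: norm_blinfun)
qed

lemma norm_cblinfun_apply_le: "norm (cblinfun_apply f x) \<le> norm f * norm x"
  by transfer (rule norm_blinfun)

text \<open>The solution of \<open>\<Sum>i\<le>k. P i (c (k - i)) = b k\<close> for \<open>c k\<close>, where \<open>\<sigma>\<close> is a right inverse of \<open>P 0\<close>.\<close>

fun lift_coeffs :: "('b \<Rightarrow> 'a) \<Rightarrow> (nat \<Rightarrow> 'a \<Rightarrow> 'b) \<Rightarrow> (nat \<Rightarrow> 'b::ab_group_add) \<Rightarrow> nat \<Rightarrow> 'a" where
  "lift_coeffs \<sigma> P b k = \<sigma> (b k - (\<Sum>j<k. P (k - j) (lift_coeffs \<sigma> P b j)))"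

declare lift_coeffs.simps [simp del]


lemma sum_diagonal_split:
  fixes f :: "nat \<Rightarrow> nat \<Rightarrow> 'a::comm_monoid_add"
  shows "(\<Sum>i\<le>k. f i (k - i)) = f 0 k + (\<Sum>j<k. f (k - j) j)"
proof -
  have "(\<Sum>i\<le>k. f i (k - i)) = (\<Sum>j\<le>k. f (k - j) j)"
    by (rule sum.reindex_bij_witness[of _ "\<lambda>j. k - j" "\<lambda>i. k - i"]) auto
  then show ?thesis by (simp add: add.commute flip: lessThan_Suc_atMost)
qed

text \<open>The coefficients chosen with a right inverse \<open>\<sigma>\<close> of \<open>P 0\<close> of bound \<open>C\<close> grow at most geometrically. With
  \<open>s k = \<Sum>j<k. S\<^sup>k\<^sup>-\<^sup>j \<parallel>c j\<parallel>\<close>, the recursion gives \<open>\<parallel>c k\<parallel> \<le> C M (s k + S\<^sup>k)\<close>, and then \<open>s k + S\<^sup>k\<close> grows by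
  a factor of at most \<open>S (1 + C M)\<close> in each step.\<close>

lemma power_series_equation_solvable:
  fixes P :: "nat \<Rightarrow> 'a::banach \<Rightarrow> 'b::banach"
  assumes lin: "bounded_linear (P 0)" and surj: "surj (P 0)"
    and P: "\<And>i x. norm (P i x) \<le> M * S ^ i * norm x" and b: "\<And>k. norm (b k) \<le> M * S ^ k"
    and "S > 0" "M \<ge> 0"
  obtains c L T where "T \<ge> S" "L \<ge> 0" "\<And>k. norm (c k) \<le> L * T ^ k"
    "\<And>k. (\<Sum>i\<le>k. P i (c (k - i))) = b k"
proof -
  obtain C where "C > 0" "\<And>y. \<exists>x. P 0 x = y \<and> norm x \<le> C * norm y"
    using surj_bounded_lift[OF lin surj] by blast
  then obtain \<sigma> where \<sigma>: "\<And>y. P 0 (\<sigma> y) = y" "\<And>y. norm (\<sigma> y) \<le> C * norm y"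
    by metis
  define c where "c = lift_coeffs \<sigma> P b"
  have c: "c k = \<sigma> (b k - (\<Sum>j<k. P (k - j) (c j)))" for k
    unfolding c_def by (subst lift_coeffs.simps) (rule refl)
  define s where "s k = (\<Sum>j<k. S ^ (k - j) * norm (c j))" for k
  have c_le: "norm (c k) \<le> C * M * (s k + S ^ k)" for k
  proof -
    have "norm (\<Sum>j<k. P (k - j) (c j)) \<le> (\<Sum>j<k. M * (S ^ (k - j) * norm (c j)))"
      using P by (intro sum_norm_le) (simp add: mult.assoc)
    then have "norm (b k - (\<Sum>j<k. P (k - j) (c j))) \<le> M * S ^ k + M * s k"
      unfolding s_def sum_distrib_left using b[of k]
      by (intro order.trans[OF norm_triangle_ineq4] add_mono)
    then have "C * norm (b k - (\<Sum>j<k. P (k - j) (c j))) \<le> C * (M * S ^ k + M * s k)"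
      using \<open>C > 0\<close> by (intro mult_left_mono) auto
    with \<sigma>(2)[of "b k - (\<Sum>j<k. P (k - j) (c j))"] show ?thesis
      by (simp add: algebra_simps flip: c)
  qed
  define T where "T = S * (1 + C * M)"
  have s_le: "s k + S ^ k \<le> T ^ k" for k
  proof (induction k)
    case (Suc k)
    have "s (Suc k) = S * s k + S * norm (c k)"
      unfolding s_def by (simp add: Suc_diff_le sum_distrib_left mult.assoc)
    also have "\<dots> \<le> S * s k + S * (C * M * (s k + S ^ k))"
      using c_le[of k] \<open>S > 0\<close> by (intro add_left_mono mult_left_mono) auto
    finally have "s (Suc k) + S ^ Suc k \<le> T * (s k + S ^ k)"
      by (simp add: T_def algebra_simps)
    also have "\<dots> \<le> T * T ^ k"
      using Suc \<open>S > 0\<close> \<open>C > 0\<close> \<open>M \<ge> 0\<close> by (intro mult_left_mono) (auto simp: T_def)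
    finally show ?case by simp
  qed (simp add: s_def)
  show thesis
  proof (rule that[of T "C * M" c])
    have "S * 1 \<le> T"
      unfolding T_def using \<open>S > 0\<close> \<open>C > 0\<close> \<open>M \<ge> 0\<close> by (intro mult_left_mono) auto
    then show "S \<le> T" by simp
    show "C * M \<ge> 0" using \<open>C > 0\<close> \<open>M \<ge> 0\<close> by simp
    show "norm (c k) \<le> C * M * T ^ k" for k
      using \<open>C > 0\<close> \<open>M \<ge> 0\<close> by (intro order.trans[OF c_le] mult_left_mono s_le) auto
    show "(\<Sum>i\<le>k. P i (c (k - i))) = b k" for k
    proof -
      have "P 0 (c k) = b k - (\<Sum>j<k. P (k - j) (c j))"
        by (subst c) (rule \<sigma>(1))
      then show ?thesis unfolding sum_diagonal_split[of "\<lambda>i j. P i (c j)"] by simp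
    qed
  qed
qed

lemma real_analytic_on_at_0E:
  fixes f :: "real \<Rightarrow> 'a::real_normed_vector"
  assumes "f real_analytic_on G" "open G" "0 \<in> G"
  obtains c \<rho> where "\<rho> > 0" "\<And>t. \<bar>t\<bar> \<le> \<rho> \<Longrightarrow> t \<in> G" "\<And>t. \<bar>t\<bar> \<le> \<rho> \<Longrightarrow> (\<lambda>i. t ^ i *\<^sub>R c i) sums f t"
proof -
  obtain c \<epsilon> where \<epsilon>: "\<epsilon> > 0" and c: "\<And>x. x \<in> G \<Longrightarrow> \<bar>x\<bar> < \<epsilon> \<Longrightarrow> (\<lambda>i. x ^ i *\<^sub>R c i) sums f x"
    using assms(1,3) unfolding real_analytic_on_def by fastforce
  obtain d where "d > 0" and d: "ball 0 d \<subseteq> G"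
    using assms(2,3) openE by blast
  have G: "t \<in> G" if "\<bar>t\<bar> < d" for t using d that by (auto simp: dist_norm)
  show thesis
  proof (rule that[of "min \<epsilon> d / 2" c])
    show "min \<epsilon> d / 2 > 0" using \<epsilon> \<open>d > 0\<close> by simp
    fix t assume "\<bar>t\<bar> \<le> min \<epsilon> d / 2"
    moreover have "min \<epsilon> d / 2 < \<epsilon>" "min \<epsilon> d / 2 < d" using \<epsilon> \<open>d > 0\<close> by auto
    ultimately have t: "\<bar>t\<bar> < \<epsilon>" "\<bar>t\<bar> < d" by linarith+
    show "t \<in> G" using t(2) by (rule G)
    then show "(\<lambda>i. t ^ i *\<^sub>R c i) sums f t" using t(1) by (rule c)
  qed
qed

lemma power_series_at_0: "(\<lambda>i. 0 ^ i *\<^sub>R c i) sums (c 0 :: 'a::real_normed_vector)"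
proof -
  have "(\<lambda>i. 0 ^ i *\<^sub>R c i) sums (\<Sum>i\<in>{0}. 0 ^ i *\<^sub>R c i)"
    by (rule sums_finite) auto
  then show ?thesis by simp
qed

lemma power_series_coeff_bound:
  fixes c :: "nat \<Rightarrow> 'a::real_normed_vector"
  assumes "summable (\<lambda>i. \<rho> ^ i *\<^sub>R c i)" "\<rho> > 0"
  obtains M where "M \<ge> 0" "\<And>i. norm (c i) \<le> M * (1 / \<rho>) ^ i"
proof -
  obtain M where M: "\<And>i. norm (\<rho> ^ i *\<^sub>R c i) \<le> M"
    using summable_imp_Bseq[OF assms(1)] by (auto simp: Bseq_def)
  show thesis
  proof (rule that[of M])
    have "norm (c 0) \<le> M" using M[of 0] by simp
    then show "M \<ge> 0" using norm_ge_zero[of "c 0"] by linarith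
    show "norm (c i) \<le> M * (1 / \<rho>) ^ i" for i
    proof -
      have "\<rho> ^ i * norm (c i) \<le> M" using M[of i] assms(2) by simp
      then have "norm (c i) \<le> M / \<rho> ^ i"
        using assms(2) by (simp add: pos_le_divide_eq mult.commute)
      then show ?thesis by (simp add: power_one_over)
    qed
  qed
qed

text \<open>Multiplying the series of \<open>\<pi>\<close> with that of the lift is a rearrangement of a double series, legitimate
  where both are dominated by geometric series of ratio \<open>1 / 2\<close>.\<close>

lemma real_analytic_lift:
  fixes \<pi> :: "real \<Rightarrow> ('a::complex_banach, 'b::complex_banach) cblinfun"
  assumes G: "open G" "0 \<in> G" and \<pi>: "\<pi> real_analytic_on G" and b: "b real_analytic_on G"
    and surj: "surj (cblinfun_apply (\<pi> 0))"
  obtains c r where "r > 0" "\<And>t. \<bar>t\<bar> < r \<Longrightarrow> t \<in> G" "summable (\<lambda>k. r ^ k * norm (c k))"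
    "\<And>t. \<bar>t\<bar> < r \<Longrightarrow> cblinfun_apply (\<pi> t) (\<Sum>k. t ^ k *\<^sub>R c k) = b t"
proof -
  interpret app: bounded_bilinear "cblinfun_apply :: ('a, 'b) cblinfun \<Rightarrow> 'a \<Rightarrow> 'b"
    by (rule bounded_bilinear_cblinfun_apply)
  obtain P \<rho>1 where \<rho>1: "\<rho>1 > 0" "\<And>t. \<bar>t\<bar> \<le> \<rho>1 \<Longrightarrow> t \<in> G"
    and P: "\<And>t. \<bar>t\<bar> \<le> \<rho>1 \<Longrightarrow> (\<lambda>i. t ^ i *\<^sub>R P i) sums \<pi> t"
    by (rule real_analytic_on_at_0E[OF \<pi> G]) (rule that)
  obtain B \<rho>2 where \<rho>2: "\<rho>2 > 0"
    and B: "\<And>t. \<bar>t\<bar> \<le> \<rho>2 \<Longrightarrow> (\<lambda>i. t ^ i *\<^sub>R B i) sums b t"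
    by (rule real_analytic_on_at_0E[OF b G]) (rule that)
  define \<rho> where "\<rho> = min \<rho>1 \<rho>2"
  have \<rho>: "\<rho> > 0" "\<rho> \<le> \<rho>1" "\<rho> \<le> \<rho>2" using \<rho>1 \<rho>2 by (auto simp: \<rho>_def)
  define S where "S = 1 / \<rho>"
  have "S > 0" using \<rho> by (simp add: S_def)
  have "summable (\<lambda>i. \<rho> ^ i *\<^sub>R P i)" "summable (\<lambda>i. \<rho> ^ i *\<^sub>R B i)"
    using \<rho> by (auto intro!: sums_summable[OF P] sums_summable[OF B])
  note coeff_bound = this[THEN power_series_coeff_bound[OF _ \<rho>(1)], folded S_def]
  obtain M1 where "M1 \<ge> 0" and M1: "\<And>i. norm (P i) \<le> M1 * S ^ i"
    by (rule coeff_bound(1)) (rule that)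
  obtain M2 where M2: "\<And>i. norm (B i) \<le> M2 * S ^ i"
    by (rule coeff_bound(2)) (rule that)
  define M where "M = max M1 M2"
  have "M \<ge> 0" using \<open>M1 \<ge> 0\<close> by (simp add: M_def)
  have "M1 * S ^ i \<le> M * S ^ i" "M2 * S ^ i \<le> M * S ^ i" for i
    using \<open>S > 0\<close> by (auto simp: M_def intro!: mult_right_mono)
  then have M: "norm (P i) \<le> M * S ^ i" "norm (B i) \<le> M * S ^ i" for i
    using order.trans[OF M1] order.trans[OF M2] by blast+
  have "\<pi> 0 = P 0"
    using sums_unique2[OF P[of 0] power_series_at_0[of P]] \<rho>1 by simp
  then have surj0: "surj (cblinfun_apply (P 0))" using surj by simp
  obtain c L T where T: "T \<ge> S" and "L \<ge> 0" and c: "\<And>k. norm (c k) \<le> L * T ^ k"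
    and conv: "\<And>k. (\<Sum>i\<le>k. cblinfun_apply (P i) (c (k - i))) = B k"
  proof (rule power_series_equation_solvable[of "\<lambda>i. cblinfun_apply (P i)" M S B])
    show "norm (cblinfun_apply (P i) x) \<le> M * S ^ i * norm x" for i x
      by (intro order.trans[OF norm_cblinfun_apply_le] mult_right_mono M) simp
  qed (use surj0 M \<open>S > 0\<close> \<open>M \<ge> 0\<close> app.bounded_linear_right in auto)
  have "T > 0" using T \<open>S > 0\<close> by simp
  \<comment> \<open>On this disc the terms of both series are dominated by powers of \<open>1 / 2\<close>.\<close>
  define r where "r = 1 / (2 * T)"
  have r: "r > 0" "r * T = 1 / 2" "r * S \<le> 1 / 2" "r \<le> \<rho>"
    using T \<open>T > 0\<close> \<open>S > 0\<close> \<rho>(1) by (auto simp: r_def S_def field_simps)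
  have c_term: "\<bar>t\<bar> ^ k * norm (c k) \<le> L * (1 / 2) ^ k" if "\<bar>t\<bar> \<le> r" for t k
  proof -
    have "\<bar>t\<bar> ^ k * norm (c k) \<le> r ^ k * (L * T ^ k)"
      using that c r(1) by (intro mult_mono power_mono) auto
    also have "\<dots> = L * (r * T) ^ k" by (simp add: power_mult_distrib)
    finally show ?thesis unfolding r(2) .
  qed
  have P_term: "\<bar>t\<bar> ^ k * norm (P k) \<le> M * (1 / 2) ^ k" if "\<bar>t\<bar> \<le> r" for t k
  proof -
    have "\<bar>t\<bar> ^ k * norm (P k) \<le> r ^ k * (M * S ^ k)"
      using that M r(1) by (intro mult_mono power_mono) auto
    also have "\<dots> = M * (r * S) ^ k" by (simp add: power_mult_distrib)
    also have "\<dots> \<le> M * (1 / 2) ^ k"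
      using r \<open>S > 0\<close> \<open>M \<ge> 0\<close> by (intro mult_left_mono power_mono) auto
    finally show ?thesis .
  qed
  have geo: "summable (\<lambda>k. K * (1 / 2 :: real) ^ k)" for K
    by (intro summable_mult summable_geometric) simp
  have c_summable: "summable (\<lambda>k. \<bar>t\<bar> ^ k * norm (c k))" if "\<bar>t\<bar> \<le> r" for t
    using c_term[OF that] by (intro summable_comparison_test'[OF geo[of L], where N = 0]) auto
  have eval: "cblinfun_apply (\<pi> t) (\<Sum>k. t ^ k *\<^sub>R c k) = b t" if t: "\<bar>t\<bar> < r" for t
  proof -
    define F where "F i j = t ^ (i + j) *\<^sub>R cblinfun_apply (P i) (c j)" for i j
    have F_le: "norm (F i j) \<le> (M * (1 / 2) ^ i) * (L * (1 / 2) ^ j)" for i j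
    proof -
      have "norm (F i j) \<le> \<bar>t\<bar> ^ (i + j) * (norm (P i) * norm (c j))"
        unfolding F_def by (auto simp: power_abs intro!: mult_left_mono norm_cblinfun_apply_le)
      also have "\<dots> = (\<bar>t\<bar> ^ i * norm (P i)) * (\<bar>t\<bar> ^ j * norm (c j))"
        by (simp add: power_add)
      also have "\<dots> \<le> (M * (1 / 2) ^ i) * (L * (1 / 2) ^ j)"
        using t \<open>M \<ge> 0\<close> by (intro mult_mono P_term c_term) auto
      finally show ?thesis .
    qed
    have "summable (\<lambda>k. \<Sum>i\<le>k. (M * (1 / 2) ^ i) * (L * (1 / 2) ^ (k - i)))"
      using geo[of M] geo[of L] \<open>M \<ge> 0\<close> \<open>L \<ge> 0\<close> by (intro summable_Cauchy_product) auto
    then have "summable (\<lambda>k. \<Sum>i\<le>k. norm (F i (k - i)))"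
    proof (rule summable_comparison_test'[where N = 0])
      fix k
      have "(\<Sum>i\<le>k. norm (F i (k - i))) \<le> (\<Sum>i\<le>k. (M * (1 / 2) ^ i) * (L * (1 / 2) ^ (k - i)))"
        by (intro sum_mono F_le)
      then show "norm (\<Sum>i\<le>k. norm (F i (k - i))) \<le> (\<Sum>i\<le>k. (M * (1 / 2) ^ i) * (L * (1 / 2) ^ (k - i)))"
        by (subst real_norm_def, subst abs_of_nonneg) (rule sum_nonneg, rule norm_ge_zero)
    qed
    then obtain V where V: "(\<lambda>k. \<Sum>i\<le>k. F i (k - i)) sums V" "(\<lambda>j. \<Sum>i. F i j) sums V"
      by (rule sums_diagonals) (rule that)
    have "(\<Sum>i\<le>k. F i (k - i)) = t ^ k *\<^sub>R B k" for k
      unfolding conv[symmetric] scaleR_sum_right by (intro sum.cong) (auto simp: F_def)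
    then have "V = b t"
      using V(1) B[of t] t r(4) \<rho>(3) by (simp add: sums_iff)
    have "(\<lambda>i. F i j) sums (t ^ j *\<^sub>R cblinfun_apply (\<pi> t) (c j))" for j
    proof -
      have "(\<lambda>i. t ^ i *\<^sub>R P i) sums \<pi> t" using t r(4) \<rho>(2) by (intro P) auto
      from sums_scaleR_right[OF bounded_linear.sums[OF app.bounded_linear_left this], of "t ^ j" "c j"]
      show ?thesis by (simp add: F_def app.scaleR_left power_add mult.commute)
    qed
    then have "(\<lambda>j. cblinfun_apply (\<pi> t) (t ^ j *\<^sub>R c j)) sums V"
      using V(2) by (simp add: sums_iff app.scaleR_right)
    moreover have "summable (\<lambda>k. t ^ k *\<^sub>R c k)"
      using c_summable[of t] t by (intro summable_norm_cancel[of "\<lambda>k. t ^ k *\<^sub>R c k"]) (auto simp: power_abs)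
    then have "(\<lambda>j. cblinfun_apply (\<pi> t) (t ^ j *\<^sub>R c j)) sums cblinfun_apply (\<pi> t) (\<Sum>k. t ^ k *\<^sub>R c k)"
      by (intro bounded_linear.sums[OF app.bounded_linear_right] summable_sums)
    ultimately show ?thesis using \<open>V = b t\<close> by (metis sums_unique2)
  qed
  show thesis
  proof (rule that[of r c])
    show "t \<in> G" if "\<bar>t\<bar> < r" for t using that r(4) \<rho>(2) by (intro \<rho>1(2)) auto
    show "summable (\<lambda>k. r ^ k * norm (c k))" using c_summable[of r] r(1) by simp
  qed (use r eval in auto)
qed

section \<open>Involutions and self-adjoint lifts\<close>

lemma star_scaleR: "star (r *\<^sub>R x) = r *\<^sub>R star (x :: 'a::banach_star_algebra_1)"
  using star_scaleC[of "complex_of_real r" x] by (simp add: scaleC_of_real)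

lemma star_one: "star 1 = (1 :: 'a::banach_star_algebra_1)"
proof -
  have "star 1 * star (star 1) = star (star 1 * (1 :: 'a))" by (simp only: star_mult)
  then show ?thesis by (simp add: star_star)
qed

text \<open>Continuity at \<open>0\<close> bounds a real-linear map; the involution need not be isometric.\<close>

lemma bounded_linear_star: "bounded_linear (star :: 'a::banach_star_algebra_1 \<Rightarrow> 'a)"
proof -
  have star_0: "star 0 = (0 :: 'a)" using star_scaleR[of 0 "0 :: 'a"] by simp
  have "isCont (star :: 'a \<Rightarrow> 'a) 0"
    using continuous_star[where 'a = 'a] by (simp add: continuous_on_eq_continuous_at)
  then obtain d where "d > 0" and "\<forall>x. dist x 0 < d \<longrightarrow> dist (star x) (star (0 :: 'a)) < 1"
    unfolding continuous_at_eps_delta by (meson zero_less_one)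
  then have d: "norm (star x) < 1" if "norm x < d" for x :: 'a
    using that by (simp add: star_0 dist_norm)
  show ?thesis
  proof (rule bounded_linear_intro[where K = "2 / d"])
    fix x :: 'a
    show "norm (star x) \<le> norm x * (2 / d)"
    proof (cases "x = 0")
      case False
      define r where "r = d / (2 * norm x)"
      have r: "r > 0" "norm (r *\<^sub>R x) < d" using False \<open>d > 0\<close> by (auto simp: r_def)
      have "r * norm (star x) < 1" using d[OF r(2)] r(1) by (simp add: star_scaleR)
      then show ?thesis using False \<open>d > 0\<close> by (simp add: r_def field_simps)
    qed (simp add: star_0)
  qed (auto simp: star_add star_scaleR)
qed

lemma poly_alg_star: "star (poly_alg p a) = poly_alg p (star (a :: 'a::banach_star_algebra_1))"
  by (rule poly_alg_hom_rev) (auto simp: star_add star_scaleR star_mult star_one)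

text \<open>The involution reverses products, but the two factors in a step are polynomials in the same element.\<close>

lemma newton_step_star:
  "star (newton_step p u a) = newton_step p u (star (a :: 'a::banach_star_algebra_1))"
proof -
  have "star (x - y) = star x - star y" for x y :: 'a
    by (rule linear_diff[OF bounded_linear.linear[OF bounded_linear_star]])
  moreover have "poly_alg u b * poly_alg p b = poly_alg p b * poly_alg u b" for b :: 'a
    by (simp add: mult.commute flip: poly_alg_mult)
  ultimately show ?thesis
    by (simp add: newton_step_def star_mult poly_alg_star)
qed

lemma cblinfun_hom:
  assumes "unital_star_hom f"
  shows "cblinfun_apply f (x + y) = cblinfun_apply f x + cblinfun_apply f y"
    "cblinfun_apply f (r *\<^sub>R x) = r *\<^sub>R cblinfun_apply f x"
    "cblinfun_apply f (x * y) = cblinfun_apply f x * cblinfun_apply f y"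
    "cblinfun_apply f 1 = 1"
    "cblinfun_apply f (star x) = star (cblinfun_apply f x)"
  using assms bounded_bilinear.add_right[OF bounded_bilinear_cblinfun_apply, of f]
    bounded_bilinear.scaleR_right[OF bounded_bilinear_cblinfun_apply, of f]
  by (auto simp: unital_star_hom_def)

text \<open>The mean of a lift and its adjoint is a lift again, because \<open>\<pi> t\<close> is a \<open>*\<close>-homomorphism and \<open>b t\<close> is
  self-adjoint.\<close>

lemma self_adjoint_analytic_lift:
  fixes \<pi> :: "real \<Rightarrow> ('a::banach_star_algebra_1, 'b::banach_star_algebra_1) cblinfun"
  assumes G: "open G" "0 \<in> G" and \<pi>: "\<pi> real_analytic_on G" and b: "b real_analytic_on G"
    and hom: "\<And>t. t \<in> G \<Longrightarrow> unital_star_hom (\<pi> t)"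
    and surj: "surj (cblinfun_apply (\<pi> 0))" and b_star: "\<And>t. t \<in> G \<Longrightarrow> star (b t) = b t"
  obtains z r where "r > 0" "\<And>t. \<bar>t\<bar> < r \<Longrightarrow> t \<in> G" "summable (\<lambda>k. r ^ k * norm (z k))"
    "\<And>t. \<bar>t\<bar> < r \<Longrightarrow> star (\<Sum>k. t ^ k *\<^sub>R z k) = (\<Sum>k. t ^ k *\<^sub>R z k)"
    "\<And>t. \<bar>t\<bar> < r \<Longrightarrow> cblinfun_apply (\<pi> t) (\<Sum>k. t ^ k *\<^sub>R z k) = b t"
proof -
  obtain c r where r: "r > 0" "\<And>t. \<bar>t\<bar> < r \<Longrightarrow> t \<in> G" and c: "summable (\<lambda>k. r ^ k * norm (c k))"
    and lift: "\<And>t. \<bar>t\<bar> < r \<Longrightarrow> cblinfun_apply (\<pi> t) (\<Sum>k. t ^ k *\<^sub>R c k) = b t"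
    by (rule real_analytic_lift[OF G \<pi> b surj]) (rule that)
  interpret star: bounded_linear "star :: 'a \<Rightarrow> 'a" by (rule bounded_linear_star)
  obtain K where K: "\<And>x :: 'a. norm (star x) \<le> norm x * K" using star.bounded by blast
  define z where "z k = (1 / 2) *\<^sub>R (c k + star (c k))" for k
  define x where "x t = (\<Sum>k. t ^ k *\<^sub>R c k)" for t
  have z_eval: "(\<Sum>k. t ^ k *\<^sub>R z k) = (1 / 2) *\<^sub>R (x t + star (x t))" if t: "\<bar>t\<bar> < r" for t
  proof -
    have "summable (\<lambda>k. norm (t ^ k *\<^sub>R c k))"
    proof (rule summable_comparison_test'[OF c, where N = 0])
      fix k
      have "\<bar>t\<bar> ^ k * norm (c k) \<le> r ^ k * norm (c k)"
        using t by (intro mult_right_mono power_mono) auto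
      then show "norm (norm (t ^ k *\<^sub>R c k)) \<le> r ^ k * norm (c k)" by (simp add: power_abs)
    qed
    then have c_sums: "(\<lambda>k. t ^ k *\<^sub>R c k) sums x t"
      unfolding x_def by (rule summable_sums[OF summable_norm_cancel])
    have "(\<lambda>k. (1 / 2) *\<^sub>R (t ^ k *\<^sub>R c k + star (t ^ k *\<^sub>R c k))) sums ((1 / 2) *\<^sub>R (x t + star (x t)))"
      by (intro sums_scaleR_right sums_add c_sums star.sums)
    then show ?thesis
      by (simp add: sums_iff z_def star_scaleR scaleR_add_right mult.commute)
  qed
  show thesis
  proof (rule that[of r z])
    have "summable (\<lambda>k. (1 + \<bar>K\<bar>) * (r ^ k * norm (c k)))"
      by (intro summable_mult c)
    then show "summable (\<lambda>k. r ^ k * norm (z k))"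
    proof (rule summable_comparison_test'[where N = 0])
      fix k
      have "norm (star (c k)) \<le> norm (c k) * \<bar>K\<bar>"
        by (intro order.trans[OF K] mult_left_mono) auto
      then have "norm (c k + star (c k)) \<le> (1 + \<bar>K\<bar>) * norm (c k)"
        using norm_triangle_ineq[of "c k" "star (c k)"] by (simp add: algebra_simps)
      moreover have "norm (z k) \<le> norm (c k + star (c k))"
        by (simp add: z_def)
      ultimately have "norm (z k) \<le> (1 + \<bar>K\<bar>) * norm (c k)"
        by linarith
      then have "r ^ k * norm (z k) \<le> r ^ k * ((1 + \<bar>K\<bar>) * norm (c k))"
        using r(1) by (intro mult_left_mono) auto
      then show "norm (r ^ k * norm (z k)) \<le> (1 + \<bar>K\<bar>) * (r ^ k * norm (c k))"
        using r(1) by (simp add: mult_ac)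
    qed
    show "star (\<Sum>k. t ^ k *\<^sub>R z k) = (\<Sum>k. t ^ k *\<^sub>R z k)" if "\<bar>t\<bar> < r" for t
      unfolding z_eval[OF that] by (simp add: star_scaleR star_add star_star add.commute)
    show "cblinfun_apply (\<pi> t) (\<Sum>k. t ^ k *\<^sub>R z k) = b t" if "\<bar>t\<bar> < r" for t
    proof -
      have "cblinfun_apply (\<pi> t) (\<Sum>k. t ^ k *\<^sub>R z k) = (1 / 2) *\<^sub>R (b t + star (b t))"
        unfolding z_eval[OF that] using lift[OF that] by (simp add: cblinfun_hom hom r(2) that x_def)
      also have "\<dots> = b t"
        using b_star[OF r(2)[OF that]] by (simp flip: scaleR_2)
      finally show ?thesis .
    qed
  qed (use r in auto)
qed

section \<open>Lifting algebraic self-adjoint elements\<close>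

theorem theorem22:
  fixes n :: nat and l :: "nat \<Rightarrow> real" and p :: "real poly"
    and G :: "real set"
    and \<pi> :: "real \<Rightarrow> ('a::banach_star_algebra_1, 'b::banach_star_algebra_1) cblinfun"
    and b :: "real \<Rightarrow> 'b"
  assumes "n \<ge> 2" and "inj_on l {1..n}"
    and "p = (\<Prod>i=1..n. [:- l i, 1:])"
    and "open G" and "0 \<in> G"
    and "\<pi> real_analytic_on G"
    and "\<And>t. t \<in> G \<Longrightarrow> unital_star_hom (\<pi> t)"
    and "surj (cblinfun_apply (\<pi> 0))"
    and "\<And>x. cblinfun_apply (\<pi> 0) x = 0 \<Longrightarrow> spectrum x = {0}"
    and "b ` G \<subseteq> S_alg p" and "b real_analytic_on G"
  shows "\<exists>H a. open H \<and> 0 \<in> H \<and> H \<subseteq> G \<and>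
    a ` H \<subseteq> S_alg p \<and> a real_analytic_on H \<and>
    (\<forall>t\<in>H. cblinfun_apply (\<pi> t) (a t) = b t)"
proof -
  note hom = assms(7)
  have b: "star (b t) = b t" "poly_alg p (b t) = 0" if "t \<in> G" for t
    using assms(10) that by (auto simp: S_alg_def)
  obtain u where u: "p dvd u * pderiv p - 1"
    by (rule squarefree_bezout[OF assms(2,3)]) (rule that)
  obtain z r where r: "r > 0" "\<And>t. \<bar>t\<bar> < r \<Longrightarrow> t \<in> G"
    and z: "summable (\<lambda>k. r ^ k * norm (z k))"
    and z_star: "\<And>t. \<bar>t\<bar> < r \<Longrightarrow> star (\<Sum>k. t ^ k *\<^sub>R z k) = (\<Sum>k. t ^ k *\<^sub>R z k)"
    and z_lift: "\<And>t. \<bar>t\<bar> < r \<Longrightarrow> cblinfun_apply (\<pi> t) (\<Sum>k. t ^ k *\<^sub>R z k) = b t"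
    by (rule self_adjoint_analytic_lift[OF assms(4,5,6,11) hom assms(8) b(1)])
      (assumption, assumption, rule that)
  define x where "x = disc_series_of (\<lambda>k. r ^ k *\<^sub>R z k)"
  have x_coeff: "disc_coeff x = (\<lambda>k. r ^ k *\<^sub>R z k)"
    unfolding x_def using z r(1) by (intro disc_coeff_disc_series_of) simp
  have x_eval: "disc_eval x s = (\<Sum>k. (r * s) ^ k *\<^sub>R z k)" for s
    by (simp add: disc_eval_def x_coeff power_mult_distrib mult.commute)
  have "cblinfun_apply (\<pi> 0) (disc_coeff x 0) = b 0"
    using z_lift[of 0] r(1) by (simp add: x_coeff sums_unique[OF power_series_at_0, symmetric])
  moreover have "cblinfun_apply (\<pi> 0) (poly_alg p (disc_coeff x 0))
      = poly_alg p (cblinfun_apply (\<pi> 0) (disc_coeff x 0))"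
    by (rule poly_alg_hom) (simp_all add: cblinfun_hom hom assms(5))
  ultimately have "spectrum (poly_alg p (disc_coeff x 0)) = {0}"
    using b(2)[OF assms(5)] by (intro assms(9)) simp
  then obtain \<rho> f where \<rho>: "0 < \<rho>" "\<rho> \<le> 1"
    and lim: "(\<lambda>k. (newton_step p u ^^ k) (dilate \<rho> x)) \<longlonglongrightarrow> f" and f_root: "poly_alg p f = 0"
    by (rule newton_converges_disc_series[OF u]) (rule that)
  \<comment> \<open>The variable of the series \<open>f\<close> is \<open>t / d\<close>: scaled by \<open>r\<close> to fit \<open>x\<close> into the unit disc, then by \<open>\<rho>\<close>.\<close>
  define d where "d = \<rho> * r"
  have d: "0 < d" "d \<le> r" using \<rho> r(1) by (auto simp: d_def mult_left_le_one_le)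
  define a where "a t = (\<Sum>k. t ^ k *\<^sub>R (1 / d ^ k) *\<^sub>R disc_coeff f k)" for t
  have a_eval: "a t = disc_eval f (t / d)" for t
    by (simp add: a_def disc_eval_def power_divide)
  define y where "y t = (\<Sum>k. t ^ k *\<^sub>R z k)" for t
  have a_lim: "(\<lambda>k. (newton_step p u ^^ k) (y t)) \<longlonglongrightarrow> a t"
    and a_root: "poly_alg p (a t) = 0" if t: "\<bar>t\<bar> < d" for t
  proof -
    have s: "\<bar>t / d\<bar> \<le> 1" using t d by (simp add: abs_divide)
    have "disc_eval (dilate \<rho> x) (t / d) = y t"
      using \<rho> r(1) by (simp add: disc_eval_dilate x_eval y_def d_def)
    moreover have "disc_eval ((newton_step p u ^^ k) (dilate \<rho> x)) (t / d)
        = (newton_step p u ^^ k) (disc_eval (dilate \<rho> x) (t / d))" for k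
      by (rule newton_step_funpow_hom[of "\<lambda>f. disc_eval f (t / d)"]) (rule disc_eval_hom[OF s])+
    ultimately show "(\<lambda>k. (newton_step p u ^^ k) (y t)) \<longlonglongrightarrow> a t"
      using tendsto_disc_eval[OF lim s] by (simp add: a_eval)
    have "disc_eval (poly_alg p f) (t / d) = poly_alg p (a t)"
      unfolding a_eval by (rule poly_alg_hom[of "\<lambda>f. disc_eval f (t / d)"]) (rule disc_eval_hom[OF s])+
    then show "poly_alg p (a t) = 0" by (simp add: f_root disc_eval_def disc_coeff_simps)
  qed
  have a_star: "star (a t) = a t" if t: "\<bar>t\<bar> < d" for t
  proof -
    have "star ((newton_step p u ^^ k) (y t)) = (newton_step p u ^^ k) (y t)" for k
      using z_star[of t] t d by (induction k) (simp_all add: newton_step_star y_def)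
    then show ?thesis
      using bounded_linear.tendsto[OF bounded_linear_star a_lim[OF t]] a_lim[OF t]
      by (auto intro: LIMSEQ_unique)
  qed
  have a_lift: "cblinfun_apply (\<pi> t) (a t) = b t" if t: "\<bar>t\<bar> < d" for t
  proof -
    have tG: "t \<in> G" using t d by (intro r(2)) simp
    have "cblinfun_apply (\<pi> t) ((newton_step p u ^^ k) (y t)) = b t" for k
    proof -
      have "cblinfun_apply (\<pi> t) ((newton_step p u ^^ k) (y t))
          = (newton_step p u ^^ k) (cblinfun_apply (\<pi> t) (y t))"
        by (rule newton_step_funpow_hom) (simp_all add: cblinfun_hom hom tG)
      also have "\<dots> = b t"
        using z_lift[of t] t d by (simp add: y_def newton_step_funpow_root b(2)[OF tG])
      finally show ?thesis .
    qed
    then have "(\<lambda>k. b t) \<longlonglongrightarrow> cblinfun_apply (\<pi> t) (a t)"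
      using bounded_linear.tendsto[OF bounded_bilinear.bounded_linear_right
          [OF bounded_bilinear_cblinfun_apply] a_lim[OF t], of "\<pi> t"] by simp
    then show ?thesis by (simp add: LIMSEQ_const_iff)
  qed
  have "summable (\<lambda>k. d ^ k * norm ((1 / d ^ k) *\<^sub>R disc_coeff f k))"
    using summable_norm_disc_coeff[of f] d(1) by simp
  then have "a real_analytic_on {- d<..<d}"
    using real_analytic_on_power_series[of d "\<lambda>k. (1 / d ^ k) *\<^sub>R disc_coeff f k"]
    by (simp add: a_def[abs_def])
  then show ?thesis
    using d r(2) a_star a_root a_lift
    by (intro exI[of _ "{- d<..<d}"] exI[of _ a]) (auto simp: S_alg_def)
qed

end
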